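(* Let $\alpha,\beta>-1$, let $\mu\ge1$ be an integer, let $\delta\in\mathbb R$ with $\beta+\delta>-1$, let $g\in C^\infty[-1,1]$, and let $f(x)=(1+x)^{\delta}\ln^{\mu}(1+x)\,g(x)$. Then the Jacobi coefficients of $f$ satisfy, as $n\to\infty$, $$|a_n(\alpha,\beta)|=\begin{cases}O\big(n^{-\beta-2\delta-1}\ln^{\mu}(n)\big), & \delta \text{ is not an integer},\\ O\big(n^{-\beta-2\delta-1}\ln^{\mu-1}(n)\big), & \delta\text{ is an integer}.\end{cases}$$
   Context: For $\alpha,\beta>-1$, $P_n^{(\alpha,\beta)}$ is the Jacobi polynomial of degree $n$ (standard normalization), $\sigma_n^{\alpha,\beta}=\int_{-1}^1(1-x)^\alpha(1+x)^\beta [P_n^{(\alpha,\beta)}(x)]^2\,dx$, and the Jacobi coefficients of $f$ are $$a_n(\alpha,\beta)=\frac{1}{\sigma_n^{\alpha,\beta}}\int_{-1}^{1}(1-x)^{\alpha}(1+x)^{\beta}f(x)P_n^{(\alpha,\beta)}(x)\,dx.$$ The constants in the $O$-terms may depend on everything except $n$.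
   Formalization: For negative integer δ the bound proved is O(n^{-β-2δ-1} ln^μ n), not ln^{μ-1}: the printed bound fails there, e.g. α=0, β=1, δ=-1, μ=1, g=1 gives |a_n| ~ 2 ln n; the ln^{μ-1} bound is proved for integers δ≥0. *)

theory Defs
  imports "HOL-Analysis.Analysis" "HOL-Library.Landau_Symbols"
begin

(* The explicit sum obtained from the Rodrigues formula by the Leibniz rule; normalised so that
   the value at 1 is (n + alpha) gchoose n. *)
definition jacobi :: "real \<Rightarrow> real \<Rightarrow> nat \<Rightarrow> real \<Rightarrow> real" where
  "jacobi \<alpha> \<beta> n x =
     (\<Sum>s\<le>n. ((real n + \<alpha>) gchoose (n - s)) * ((real n + \<beta>) gchoose s)
            * ((x - 1) / 2) ^ s * ((x + 1) / 2) ^ (n - s))"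

definition jacobi_weight :: "real \<Rightarrow> real \<Rightarrow> real \<Rightarrow> real" where
  "jacobi_weight \<alpha> \<beta> x = (1 - x) powr \<alpha> * (1 + x) powr \<beta>"

definition jacobi_sqnorm :: "real \<Rightarrow> real \<Rightarrow> nat \<Rightarrow> real" where
  "jacobi_sqnorm \<alpha> \<beta> n = integral {-1..1} (\<lambda>x. jacobi_weight \<alpha> \<beta> x * (jacobi \<alpha> \<beta> n x)\<^sup>2)"

definition jacobi_coeff :: "(real \<Rightarrow> real) \<Rightarrow> real \<Rightarrow> real \<Rightarrow> nat \<Rightarrow> real" where
  "jacobi_coeff f \<alpha> \<beta> n =
     1 / jacobi_sqnorm \<alpha> \<beta> n
       * integral {-1..1} (\<lambda>x. jacobi_weight \<alpha> \<beta> x * f x * jacobi \<alpha> \<beta> n x)"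

(* Derivatives of all orders on the closed set S, one-sided at the boundary of an interval;
   D k is the k-th derivative. *)
definition smooth_on :: "real set \<Rightarrow> (real \<Rightarrow> real) \<Rightarrow> bool" where
  "smooth_on S g \<longleftrightarrow>
     (\<exists>D :: nat \<Rightarrow> real \<Rightarrow> real. (\<forall>x\<in>S. D 0 x = g x) \<and>
        (\<forall>k. \<forall>x\<in>S. (D k has_real_derivative D (Suc k) x) (at x within S)))"

lemma jacobi_at_1: "jacobi \<alpha> \<beta> n 1 = (real n + \<alpha>) gchoose n"
proof -
  have "jacobi \<alpha> \<beta> n 1 = (\<Sum>s\<le>n. if s = 0 then (real n + \<alpha>) gchoose n else 0)"
    unfolding jacobi_def by (rule sum.cong) auto
  then show ?thesis by simp
qed

end

theory Submission
  imports Defs "HOL-Real_Asymp.Real_Asymp"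
begin

text \<open>
  Write W(a, b, n) for the weight times the Jacobi polynomial of degree n. The derivative of
  W(a + 1, b + 1, n) is - 2 (n + 1) W(a, b, n + 1), so k integrations by parts replace the integral of
  W(a, b, n) F by a multiple of the integral of W(a + k, b + k, n - k) times the k-th derivative of F.
  This is used in three ways.

  Taking k = n and F the Jacobi polynomial itself evaluates the square norm, which is of
  order 1 / n.

  Taking k = n and F = (1 + x) powr d * ln (1 + x) ^ m, the n-th derivative is (1 + x) powr (d - n) times a
  polynomial in ln (1 + x) whose coefficients are those of the product of d - j + z over j < n, as a
  polynomial in z. They and the powers of the logarithm are estimated by Cauchy's trick: a power
  series with nonnegative coefficients is evaluated at r = 1 / ln n, where n powr r = e and each power of
  1 / r costs one logarithm. If d is a nonnegative integer, the product contains the factor z, which saves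
  one logarithm.

  Taking k fixed and F the product of the singular factor with the Taylor remainder of g at -1, the
  k-th derivative is bounded, which gives O(n powr (- k)). Expanding g at -1 to high order combines the two
  estimates.
\<close>

section \<open>Integration by parts against Jacobi polynomials\<close>

definition wjac :: "real \<Rightarrow> real \<Rightarrow> nat \<Rightarrow> real \<Rightarrow> real" where
  "wjac a b n x = jacobi_weight a b x * jacobi a b n x"

lemma gbinomial_step:
  "(a - real k) * (a gchoose k) = (real k + 1) * (a gchoose Suc k)" for a :: real
  by (simp add: gbinomial_mult_1 algebra_simps)

text \<open>Absorbing the integer powers into real exponents makes each summand a product of two
  real powers, to which one differentiation rule applies for every s.\<close>

lemma wjac_expand:
  assumes x: "x \<in> {-1<..<1}"
  shows "wjac a b n x = (1/2) ^ n * (\<Sum>s\<le>n. (-1) ^ s * ((real n + a) gchoose (n - s)) * ((real n + b) gchoose s)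
           * ((1 - x) powr (a + real s) * (1 + x) powr (b + (real n - real s))))"
proof -
  have *: "jacobi_weight a b x * (((real n + a) gchoose (n - s)) * ((real n + b) gchoose s)
            * ((x - 1) / 2) ^ s * ((x + 1) / 2) ^ (n - s)) =
        (1/2) ^ n * ((-1) ^ s * ((real n + a) gchoose (n - s)) * ((real n + b) gchoose s)
           * ((1 - x) powr (a + real s) * (1 + x) powr (b + (real n - real s))))" if "s \<le> n" for s
  proof -
    have 1: "(1 - x) powr (a + real s) = (1 - x) powr a * (1 - x) ^ s"
      using x by (simp add: powr_add powr_realpow)
    have 2: "(1 + x) powr (b + (real n - real s)) = (1 + x) powr b * (1 + x) ^ (n - s)"
      using x that by (simp add: powr_add powr_realpow flip: of_nat_diff)
    have "((x - 1) / 2) ^ s = (-1) ^ s * (1 - x) ^ s * (1/2) ^ s"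
      by (simp flip: power_mult_distrib add: field_simps)
    moreover have "((x + 1) / 2) ^ (n - s) = (1 + x) ^ (n - s) * (1/2) ^ (n - s)"
      by (simp flip: power_mult_distrib add: field_simps)
    moreover have "(1/2 :: real) ^ n = (1/2) ^ s * (1/2) ^ (n - s)"
      using that by (simp flip: power_add)
    ultimately show ?thesis
      by (simp only: 1 2 jacobi_weight_def mult_ac)
  qed
  show ?thesis
    unfolding wjac_def jacobi_def sum_distrib_left by (rule sum.cong) (use * in auto)
qed

text \<open>Differentiating term s gives multiples of the terms s and s + 1 of the expansion of
  degree n + 1. The absorption identity \<open>gbinomial_step\<close> turns the multipliers into -
  (n + 1 - s) and - (s + 1), so term s collects - (n + 1 - s) - s = - (n + 1) in total. The factor 2
  adjusts the power of 1/2.\<close>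

lemma wjac_has_derivative:
  assumes x: "x \<in> {-1<..<1}"
  shows "(wjac (a + 1) (b + 1) n has_real_derivative - 2 * real (Suc n) * wjac a b (Suc n) x) (at x)"
proof -
  define K where "K s = ((real n + 1 + a) gchoose (Suc n - s)) * ((real n + 1 + b) gchoose s)" for s
  define T where "T s = (-1) ^ s * ((1 - x) powr (a + real s) * (1 + x) powr (b + (real n + 1 - real s)))" for s
  define G where "G y = (1/2) ^ n * (\<Sum>s\<le>n. (-1) ^ s * ((real n + (a + 1)) gchoose (n - s)) * ((real n + (b + 1)) gchoose s)
           * ((1 - y) powr ((a + 1) + real s) * (1 + y) powr ((b + 1) + (real n - real s))))" for y
  define D where "D s = (-1) ^ s * ((real n + (a + 1)) gchoose (n - s)) * ((real n + (b + 1)) gchoose s)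
           * (- (a + 1 + real s) * (1 - x) powr (a + real s) * (1 + x) powr (b + 1 + (real n - real s))
              + (b + 1 + (real n - real s)) * (1 - x) powr (a + 1 + real s) * (1 + x) powr (b + (real n - real s)))" for s
  have "(G has_real_derivative (1/2) ^ n * (\<Sum>s\<le>n. D s)) (at x)"
    unfolding G_def D_def using x
    by (auto intro!: derivative_eq_intros sum.cong simp: algebra_simps)
  moreover have "D s = - (real n + 1 - real s) * K s * T s - real (Suc s) * K (Suc s) * T (Suc s)" if "s \<le> n" for s
  proof -
    have 1: "(a + 1 + real s) * ((real n + (a + 1)) gchoose (n - s)) = (real n + 1 - real s) * ((real n + 1 + a) gchoose (Suc n - s))"
      using gbinomial_step[of "real n + (a + 1)" "n - s"] that
      by (simp add: algebra_simps of_nat_diff Suc_diff_le)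
    have 2: "(b + 1 + (real n - real s)) * ((real n + (b + 1)) gchoose s) = real (Suc s) * ((real n + 1 + b) gchoose Suc s)"
      using gbinomial_step[of "real n + (b + 1)" s] by (simp add: algebra_simps)
    have "D s = (-1) ^ s * (- ((a + 1 + real s) * ((real n + (a + 1)) gchoose (n - s))) * ((real n + 1 + b) gchoose s)
           * ((1 - x) powr (a + real s) * (1 + x) powr (b + (real n + 1 - real s)))
        + ((b + 1 + (real n - real s)) * ((real n + (b + 1)) gchoose s)) * ((real n + 1 + a) gchoose (n - s))
           * ((1 - x) powr (a + real (Suc s)) * (1 + x) powr (b + (real n + 1 - real (Suc s)))))"
      unfolding D_def by (simp add: algebra_simps)
    also have "\<dots> = - (real n + 1 - real s) * K s * T s - real (Suc s) * K (Suc s) * T (Suc s)"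
      unfolding 1 2 K_def T_def by (simp add: algebra_simps)
    finally show ?thesis .
  qed
  then have "(\<Sum>s\<le>n. D s) = (\<Sum>s\<le>n. - (real n + 1 - real s) * K s * T s) - (\<Sum>s\<le>n. real (Suc s) * K (Suc s) * T (Suc s))"
    by (simp add: sum_subtractf)
  \<comment> \<open>The added term s = n + 1 carries the factor 0, and so does the term s = 0 that
    the next shift prepends.\<close>
  also have "(\<Sum>s\<le>n. - (real n + 1 - real s) * K s * T s) = (\<Sum>s\<le>Suc n. - (real n + 1 - real s) * K s * T s)"
    by simp
  also have "(\<Sum>s\<le>n. real (Suc s) * K (Suc s) * T (Suc s)) = (\<Sum>s\<le>Suc n. real s * K s * T s)"
    by (simp only: sum.atMost_Suc_shift)
  also have "(\<Sum>s\<le>Suc n. - (real n + 1 - real s) * K s * T s) - (\<Sum>s\<le>Suc n. real s * K s * T s)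
      = - real (Suc n) * (\<Sum>s\<le>Suc n. K s * T s)"
    unfolding sum_subtractf[symmetric] sum_distrib_left by (rule sum.cong) (auto simp: algebra_simps)
  also have "(1/2) ^ n * \<dots> = - 2 * real (Suc n) * wjac a b (Suc n) x"
    unfolding wjac_expand[OF x] K_def T_def by (simp add: add_ac mult_ac)
  finally have "(G has_real_derivative - 2 * real (Suc n) * wjac a b (Suc n) x) (at x)" .
  then show ?thesis
    by (rule has_field_derivative_transform_within_open[where S = "{-1<..<1}"])
      (use x in \<open>auto simp: G_def wjac_expand\<close>)
qed

text \<open>The substitution t = (1 + x) / 2 leads to Euler's Beta integral.\<close>

lemma has_integral_jacobi_weight:
  assumes "a > -1" "b > -1"
  shows "(jacobi_weight a b has_integral 2 powr (a + b + 1) * Beta (a + 1) (b + 1)) {-1..1}"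
proof -
  have "((\<lambda>t. t powr b * (1 - t) powr a) has_integral Beta (a + 1) (b + 1)) (cbox 0 1)"
    using has_integral_Beta_real[of "b + 1" "a + 1"] assms by (simp add: Beta_commute)
  from has_integral_affinity'[OF this, of "1/2" "1/2"]
  have "((\<lambda>x. (x / 2 + 1 / 2) powr b * (1 / 2 - x / 2) powr a) has_integral 2 * Beta (a + 1) (b + 1)) {-1..1}"
    by (simp add: scaleR_conv_of_real algebra_simps)
  from has_integral_mult_right[OF this, of "2 powr (a + b)"]
  have "((\<lambda>x. 2 powr (a + b) * ((x / 2 + 1 / 2) powr b * (1 / 2 - x / 2) powr a)) has_integral
          2 powr (a + b + 1) * Beta (a + 1) (b + 1)) {-1..1}"
    by (simp add: powr_add mult_ac)
  then show ?thesis
  proof (rule has_integral_eq[rotated])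
    fix x :: real assume x: "x \<in> {-1..1}"
    have "x / 2 + 1 / 2 = (1 + x) / 2" "1 / 2 - x / 2 = (1 - x) / 2" by auto
    moreover have "((1 + x) / 2) powr b = (1 + x) powr b / 2 powr b" "((1 - x) / 2) powr a = (1 - x) powr a / 2 powr a"
      using x by (auto intro!: powr_divide)
    ultimately show "2 powr (a + b) * ((x / 2 + 1 / 2) powr b * (1 / 2 - x / 2) powr a) = jacobi_weight a b x"
      by (simp only:) (simp add: powr_add jacobi_weight_def)
  qed
qed

section \<open>Functions with power bounds at -1 on all derivatives\<close>

text \<open>F j is the j-th derivative of F 0; each derivative may cost one power of 1 + x.\<close>
definition symbol :: "(nat \<Rightarrow> real \<Rightarrow> real) \<Rightarrow> real \<Rightarrow> bool" where
  "symbol F s \<longleftrightarrow>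
     (\<forall>j. (\<forall>x\<in>{-1<..<1}. (F j has_real_derivative F (Suc j) x) (at x)) \<and>
          (\<exists>C. \<forall>x\<in>{-1<..<1}. \<bar>F j x\<bar> \<le> C * (1 + x) powr (s - real j)))"

lemma symbolD:
  assumes "symbol F s"
  shows "x \<in> {-1<..<1} \<Longrightarrow> (F j has_real_derivative F (Suc j) x) (at x)"
    and "\<exists>C\<ge>0. \<forall>x\<in>{-1<..<1}. \<bar>F j x\<bar> \<le> C * (1 + x) powr (s - real j)"
proof -
  show "x \<in> {-1<..<1} \<Longrightarrow> (F j has_real_derivative F (Suc j) x) (at x)"
    using assms unfolding symbol_def by blast
  obtain C where "\<forall>x\<in>{-1<..<1}. \<bar>F j x\<bar> \<le> C * (1 + x) powr (s - real j)"
    using assms unfolding symbol_def by blast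
  then have "\<forall>x\<in>{-1<..<1}. \<bar>F j x\<bar> \<le> \<bar>C\<bar> * (1 + x) powr (s - real j)"
    by (meson abs_ge_self mult_right_mono order_trans powr_ge_zero)
  then show "\<exists>C\<ge>0. \<forall>x\<in>{-1<..<1}. \<bar>F j x\<bar> \<le> C * (1 + x) powr (s - real j)"
    by (intro exI[of _ "\<bar>C\<bar>"]) auto
qed

lemma symbol_shift:
  assumes "symbol F s"
  shows "symbol (\<lambda>j. F (Suc j)) (s - 1)"
  unfolding symbol_def
proof (intro allI conjI)
  fix j
  show "\<forall>x\<in>{-1<..<1}. (F (Suc j) has_real_derivative F (Suc (Suc j)) x) (at x)"
    using symbolD(1)[OF assms] by blast
  have "s - 1 - real j = s - real (Suc j)" by simp
  then show "\<exists>C. \<forall>x\<in>{-1<..<1}. \<bar>F (Suc j) x\<bar> \<le> C * (1 + x) powr (s - 1 - real j)"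
    using symbolD(2)[OF assms, of "Suc j"] by metis
qed

text \<open>Leibniz's rule. The orders add because term i loses i powers of 1 + x through U and j -
  i through V, hence j in all.\<close>

lemma symbol_mult:
  assumes U: "symbol U s" and V: "symbol V t"
  shows "symbol (\<lambda>j x. \<Sum>i\<le>j. real (j choose i) * (U i x * V (j - i) x)) (s + t)"
  unfolding symbol_def
proof (intro allI conjI ballI)
  fix j and x :: real assume x: "x \<in> {-1<..<1}"
  have "((\<lambda>x. \<Sum>i\<le>j. real (j choose i) * (U i x * V (j - i) x)) has_real_derivative
      (\<Sum>i\<le>j. real (j choose i) * (U (Suc i) x * V (j - i) x + V (Suc (j - i)) x * U i x))) (at x)"
    by (intro DERIV_sum DERIV_cmult DERIV_mult symbolD(1)[OF U x] symbolD(1)[OF V x])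
  also have "(\<Sum>i\<le>j. real (j choose i) * (U (Suc i) x * V (j - i) x + V (Suc (j - i)) x * U i x))
      = (\<Sum>i\<le>j. real (j choose i) * (U (Suc i) x * V (j - i) x))
        + (\<Sum>i\<le>j. real (j choose i) * (U i x * V (Suc j - i) x))"
    unfolding sum.distrib[symmetric] by (intro sum.cong) (auto simp: algebra_simps Suc_diff_le)
  \<comment> \<open>The extra term has the coefficient j choose j + 1, which is 0; it prepares
    Pascal's rule below.\<close>
  also have "(\<Sum>i\<le>j. real (j choose i) * (U i x * V (Suc j - i) x))
      = (\<Sum>i\<le>Suc j. real (j choose i) * (U i x * V (Suc j - i) x))"
    by simp
  also have "\<dots> = U 0 x * V (Suc j) x + (\<Sum>i\<le>j. real (j choose Suc i) * (U (Suc i) x * V (j - i) x))"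
    by (simp only: sum.atMost_Suc_shift) simp
  also have "(\<Sum>i\<le>j. real (j choose i) * (U (Suc i) x * V (j - i) x)) + \<dots>
      = U 0 x * V (Suc j) x + (\<Sum>i\<le>j. real (Suc j choose Suc i) * (U (Suc i) x * V (j - i) x))"
    by (simp add: algebra_simps sum.distrib)
  also have "\<dots> = (\<Sum>i\<le>Suc j. real (Suc j choose i) * (U i x * V (Suc j - i) x))"
    by (simp only: sum.atMost_Suc_shift) simp
  finally show "((\<lambda>x. \<Sum>i\<le>j. real (j choose i) * (U i x * V (j - i) x)) has_real_derivative
      (\<Sum>i\<le>Suc j. real (Suc j choose i) * (U i x * V (Suc j - i) x))) (at x)" .
next
  fix j
  obtain A where A: "\<And>i. A i \<ge> 0" "\<And>i x. x \<in> {-1<..<1} \<Longrightarrow> \<bar>U i x\<bar> \<le> A i * (1 + x) powr (s - real i)"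
    using symbolD(2)[OF U] by metis
  obtain B where B: "\<And>i. B i \<ge> 0" "\<And>i x. x \<in> {-1<..<1} \<Longrightarrow> \<bar>V i x\<bar> \<le> B i * (1 + x) powr (t - real i)"
    using symbolD(2)[OF V] by metis
  show "\<exists>C. \<forall>x\<in>{-1<..<1}. \<bar>\<Sum>i\<le>j. real (j choose i) * (U i x * V (j - i) x)\<bar> \<le> C * (1 + x) powr (s + t - real j)"
  proof (intro exI ballI)
    fix x :: real assume x: "x \<in> {-1<..<1}"
    have "\<bar>\<Sum>i\<le>j. real (j choose i) * (U i x * V (j - i) x)\<bar>
        \<le> (\<Sum>i\<le>j. \<bar>real (j choose i) * (U i x * V (j - i) x)\<bar>)"
      by (rule sum_abs)
    also have "\<dots> \<le> (\<Sum>i\<le>j. real (j choose i) * (A i * B (j - i)) * (1 + x) powr (s + t - real j))"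
    proof (rule sum_mono)
      fix i assume i: "i \<in> {..j}"
      have "\<bar>U i x\<bar> * \<bar>V (j - i) x\<bar> \<le> (A i * (1 + x) powr (s - real i)) * (B (j - i) * (1 + x) powr (t - real (j - i)))"
        using x A B by (intro mult_mono) auto
      also have "\<dots> = A i * B (j - i) * (1 + x) powr ((s - real i) + (t - real (j - i)))"
        by (simp add: powr_add)
      also have "(s - real i) + (t - real (j - i)) = s + t - real j"
        using i by (simp add: of_nat_diff)
      finally show "\<bar>real (j choose i) * (U i x * V (j - i) x)\<bar> \<le> real (j choose i) * (A i * B (j - i)) * (1 + x) powr (s + t - real j)"
        by (simp add: abs_mult mult_left_mono mult.assoc)
    qed
    finally show "\<bar>\<Sum>i\<le>j. real (j choose i) * (U i x * V (j - i) x)\<bar> \<le>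
        (\<Sum>i\<le>j. real (j choose i) * (A i * B (j - i))) * (1 + x) powr (s + t - real j)"
      by (simp add: sum_distrib_right)
  qed
qed

text \<open>For j >= k the exponent k - j is at most 0 and 1 + x < 2, so the required majorant is
  bounded below by a positive constant and plain boundedness suffices. This serves polynomials, with
  k = 0, and Taylor remainders.\<close>

lemma symbol_bounded:
  assumes d: "\<And>j x. x \<in> {-1<..<1} \<Longrightarrow> (F j has_real_derivative F (Suc j) x) (at x)"
    and b: "\<And>j. j < k \<Longrightarrow> \<exists>C. \<forall>x\<in>{-1<..<1}. \<bar>F j x\<bar> \<le> C * (1 + x) powr (real k - real j)"
    and b': "\<And>j. j \<ge> k \<Longrightarrow> \<exists>C. \<forall>x\<in>{-1<..<1}. \<bar>F j x\<bar> \<le> C"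
  shows "symbol F (real k)"
  unfolding symbol_def
proof (intro allI conjI)
  fix j
  show "\<forall>x\<in>{-1<..<1}. (F j has_real_derivative F (Suc j) x) (at x)" using d by blast
  show "\<exists>C. \<forall>x\<in>{-1<..<1}. \<bar>F j x\<bar> \<le> C * (1 + x) powr (real k - real j)"
  proof (cases "j < k")
    case False
    then obtain C where C: "\<forall>x\<in>{-1<..<1}. \<bar>F j x\<bar> \<le> C" using b' by force
    show ?thesis
    proof (intro exI ballI)
      fix x :: real assume x: "x \<in> {-1<..<1}"
      have "C \<ge> 0" using C x by force
      have "(2::real) powr (real k - real j) \<le> (1 + x) powr (real k - real j)"
        using x False by (intro powr_mono2') auto
      then have "C * 2 powr (real k - real j) \<le> C * (1 + x) powr (real k - real j)"
        using \<open>C \<ge> 0\<close> by (intro mult_left_mono)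
      then have "C \<le> C * (1 + x) powr (real k - real j) / 2 powr (real k - real j)"
        by (simp add: field_simps)
      then show "\<bar>F j x\<bar> \<le> (C / 2 powr (real k - real j)) * (1 + x) powr (real k - real j)"
        using C x by force
    qed
  qed (use b in auto)
qed

section \<open>Integrability and integration by parts\<close>

lemma jacobi_bounded:
  obtains M where "M \<ge> 0" "\<And>x. x \<in> {-1..1} \<Longrightarrow> \<bar>jacobi a b n x\<bar> \<le> M"
proof -
  have "continuous_on {-1..1} (jacobi a b n)"
    unfolding jacobi_def[abs_def] by (intro continuous_intros) auto
  then have "bounded (jacobi a b n ` {-1..1})"
    by (intro compact_imp_bounded compact_continuous_image) auto
  then obtain M where "\<forall>x\<in>{-1..1}. \<bar>jacobi a b n x\<bar> \<le> M"
    unfolding bounded_iff by auto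
  then show ?thesis using that[of "max 0 M"] by (auto simp: le_max_iff_disj)
qed

lemma wjac_symbol_bound:
  assumes "symbol F s"
  obtains C where "C \<ge> 0" "\<And>x. x \<in> {-1<..<1} \<Longrightarrow> \<bar>wjac a b n x * F 0 x\<bar> \<le> C * jacobi_weight a (b + s) x"
proof -
  obtain M where M: "M \<ge> 0" "\<And>x. x \<in> {-1..1} \<Longrightarrow> \<bar>jacobi a b n x\<bar> \<le> M"
    using jacobi_bounded[of a b n] by blast
  obtain C where C: "C \<ge> 0" "\<And>x. x \<in> {-1<..<1} \<Longrightarrow> \<bar>F 0 x\<bar> \<le> C * (1 + x) powr s"
    using symbolD(2)[OF assms, of 0] by auto
  show ?thesis
  proof (rule that)
    show "M * C \<ge> 0" using M C by simp
    fix x :: real assume x: "x \<in> {-1<..<1}"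
    have "\<bar>jacobi a b n x\<bar> * \<bar>F 0 x\<bar> \<le> M * (C * (1 + x) powr s)"
      using x M C by (intro mult_mono) auto
    then have "jacobi_weight a b x * (\<bar>jacobi a b n x\<bar> * \<bar>F 0 x\<bar>) \<le> jacobi_weight a b x * (M * (C * (1 + x) powr s))"
      by (intro mult_left_mono) (auto simp: jacobi_weight_def)
    then show "\<bar>wjac a b n x * F 0 x\<bar> \<le> M * C * jacobi_weight a (b + s) x"
      by (simp add: wjac_def jacobi_weight_def powr_add abs_mult mult_ac)
  qed
qed

text \<open>Continuity on the open interval gives measurability, the majorant of
  \<open>wjac_symbol_bound\<close> gives integrability, and the endpoints form a null set.\<close>

lemma wjac_symbol_integrable:
  assumes F: "symbol F s" and "a > -1" "b + s > -1"
  shows "(\<lambda>x. wjac a b n x * F 0 x) integrable_on {-1..1}"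
proof -
  obtain C where C: "\<And>x. x \<in> {-1<..<1} \<Longrightarrow> \<bar>wjac a b n x * F 0 x\<bar> \<le> C * jacobi_weight a (b + s) x"
    using wjac_symbol_bound[OF F] by metis
  have "continuous_on {-1<..<1} (\<lambda>x. wjac a b n x * F 0 x)"
    unfolding wjac_def jacobi_weight_def jacobi_def
    by (intro continuous_intros DERIV_continuous_on[where D = "F 1"])
       (use symbolD(1)[OF F] in \<open>auto intro: has_field_derivative_at_within\<close>)
  then have m: "(\<lambda>x. wjac a b n x * F 0 x) \<in> borel_measurable (lebesgue_on {-1<..<1})"
    by (intro continuous_imp_measurable_on_sets_lebesgue) auto
  have "(jacobi_weight a (b + s)) integrable_on {-1..1}"
    using has_integral_jacobi_weight[of a "b + s"] assms by blast
  then have "(\<lambda>x. C * jacobi_weight a (b + s) x) integrable_on {-1<..<1}"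
    by (simp add: integrable_on_Icc_iff_Ioo integrable_on_mult_right)
  from measurable_bounded_by_integrable_imp_integrable_real[OF m this]
  have "(\<lambda>x. wjac a b n x * F 0 x) integrable_on {-1<..<1}"
    using C by auto
  then show ?thesis by (simp add: integrable_on_Icc_iff_Ioo)
qed

text \<open>The boundary terms vanish although F may be unbounded at -1: with both weight exponents
  raised by one, the majorant has the positive exponents a + 1 and b + 1 + s.\<close>

lemma integral_wjac_by_parts:
  assumes F: "symbol F s" and ab: "a > -1" "b > -1" "b + s > -1"
  shows "integral {-1..1} (\<lambda>x. wjac a b (Suc n) x * F 0 x)
     = 1 / (2 * real (Suc n)) * integral {-1..1} (\<lambda>x. wjac (a + 1) (b + 1) n x * F 1 x)"
proof -
  define G where "G x = wjac (a + 1) (b + 1) n x * F 0 x" for x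
  \<comment> \<open>\<open>0 powr t\<close> is 0 for every t, so G vanishes at the endpoints
    whatever values F takes there.\<close>
  have G0: "G 1 = 0" "G (-1) = 0" by (auto simp: G_def wjac_def jacobi_weight_def)
  have dG: "(G has_real_derivative (- 2 * real (Suc n) * (wjac a b (Suc n) x * F 0 x) + wjac (a + 1) (b + 1) n x * F 1 x)) (at x)"
    if "x \<in> {-1<..<1}" for x
    unfolding G_def using DERIV_mult[OF wjac_has_derivative[OF that, of a b n] symbolD(1)[OF F that, of 0]]
    by (simp add: mult_ac)
  obtain C where C: "C \<ge> 0" "\<And>x. x \<in> {-1<..<1} \<Longrightarrow> \<bar>G x\<bar> \<le> C * jacobi_weight (a + 1) (b + 1 + s) x"
    unfolding G_def using wjac_symbol_bound[OF F] by metis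
  \<comment> \<open>A continuous majorant of G that is 0 at both ends; it forces the continuity of G
    there.\<close>
  define H where "H x = C * jacobi_weight (a + 1) (b + 1 + s) x" for x
  have H: "continuous_on {-1..1} H"
    unfolding H_def jacobi_weight_def using ab by (intro continuous_intros continuous_on_powr') auto
  have GH: "\<bar>G x\<bar> \<le> H x" if "x \<in> {-1..1}" for x
  proof (cases "x \<in> {-1<..<1}")
    case False
    then have "x = 1 \<or> x = -1" using that by auto
    then show ?thesis using G0 by (auto simp: H_def jacobi_weight_def)
  qed (use C H_def in auto)
  have end0: "(G \<longlongrightarrow> 0) (at x within {-1..1})" if "x = 1 \<or> x = -1" for x
  proof (rule Lim_null_comparison)
    show "\<forall>\<^sub>F y in at x within {-1..1}. norm (G y) \<le> H y"
      unfolding eventually_at_filter using GH by (auto intro!: always_eventually)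
    have "H x = 0" "x \<in> {-1..1}" using that by (auto simp: H_def jacobi_weight_def)
    then show "(H \<longlongrightarrow> 0) (at x within {-1..1})"
      using H unfolding continuous_on_def by metis
  qed
  have "continuous_on {-1..1} G"
    unfolding continuous_on_def
  proof
    fix x :: real assume x: "x \<in> {-1..1}"
    show "(G \<longlongrightarrow> G x) (at x within {-1..1})"
    proof (cases "x \<in> {-1<..<1}")
      case True
      show ?thesis using DERIV_isCont[OF dG[OF True]] unfolding isCont_def
        by (rule tendsto_within_subset) auto
    next
      case False
      then have "x = 1 \<or> x = -1" using x by auto
      then show ?thesis using end0 G0 by auto
    qed
  qed
  then have "((\<lambda>x. - 2 * real (Suc n) * (wjac a b (Suc n) x * F 0 x) + wjac (a + 1) (b + 1) n x * F 1 x)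
      has_integral G 1 - G (-1)) {-1..1}"
    using dG by (intro fundamental_theorem_of_calculus_interior)
      (auto simp: has_real_derivative_iff_has_vector_derivative)
  then have "integral {-1..1} (\<lambda>x. - 2 * real (Suc n) * (wjac a b (Suc n) x * F 0 x) + wjac (a + 1) (b + 1) n x * F 1 x) = 0"
    using G0 by (simp add: integral_unique)
  moreover have "integral {-1..1} (\<lambda>x. - 2 * real (Suc n) * (wjac a b (Suc n) x * F 0 x) + wjac (a + 1) (b + 1) n x * F 1 x)
     = - 2 * real (Suc n) * integral {-1..1} (\<lambda>x. wjac a b (Suc n) x * F 0 x)
       + integral {-1..1} (\<lambda>x. wjac (a + 1) (b + 1) n x * F 1 x)"
  proof -
    have i: "(\<lambda>x. wjac a b (Suc n) x * F 0 x) integrable_on {-1..1}"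
      using wjac_symbol_integrable[OF F] ab by auto
    have i': "(\<lambda>x. wjac (a + 1) (b + 1) n x * F 1 x) integrable_on {-1..1}"
      using wjac_symbol_integrable[OF symbol_shift[OF F], of "a + 1" "b + 1"] ab by auto
    show ?thesis
      by (intro integral_unique has_integral_add has_integral_mult_right integrable_integral i i')
  qed
  ultimately have e: "integral {-1..1} (\<lambda>x. wjac (a + 1) (b + 1) n x * F 1 x)
      = 2 * real (Suc n) * integral {-1..1} (\<lambda>x. wjac a b (Suc n) x * F 0 x)"
    by linarith
  show ?thesis unfolding e by (simp del: of_nat_Suc)
qed

text \<open>One step replaces F by its derivative, s by s - 1 and b by b + 1. This preserves b + s,
  and the induction has to run over all F, s, a, b and n at once.\<close>

lemma integral_wjac_iterated_parts:
  assumes "symbol F s" "a > -1" "b > -1" "b + s > -1" "k \<le> n"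
  shows "integral {-1..1} (\<lambda>x. wjac a b n x * F 0 x)
     = fact (n - k) / (2 ^ k * fact n) * integral {-1..1} (\<lambda>x. wjac (a + real k) (b + real k) (n - k) x * F k x)"
  using assms
proof (induction k arbitrary: F s a b n)
  case (Suc k)
  then obtain m where n: "n = Suc m" "k \<le> m" by (cases n) auto
  have "integral {-1..1} (\<lambda>x. wjac a b n x * F 0 x)
      = 1 / (2 * real (Suc m)) * integral {-1..1} (\<lambda>x. wjac (a + 1) (b + 1) m x * F (Suc 0) x)"
    unfolding n using integral_wjac_by_parts[OF Suc.prems(1-4)] by simp
  also have "integral {-1..1} (\<lambda>x. wjac (a + 1) (b + 1) m x * F (Suc 0) x)
      = fact (m - k) / (2 ^ k * fact m) * integral {-1..1} (\<lambda>x. wjac (a + 1 + real k) (b + 1 + real k) (m - k) x * F (Suc k) x)"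
    by (rule Suc.IH[OF symbol_shift[OF Suc.prems(1)]]) (use Suc.prems n in auto)
  finally show ?case using n by (simp add: add_ac)
qed simp

section \<open>The square norm\<close>

lemma symbol_poly: "symbol (\<lambda>j. poly ((pderiv ^^ j) p)) 0"
proof -
  have "symbol (\<lambda>j. poly ((pderiv ^^ j) p)) (real 0)"
  proof (rule symbol_bounded)
    fix j :: nat
    have "bounded (poly ((pderiv ^^ j) p) ` {-1..1})"
      by (intro compact_imp_bounded compact_continuous_image continuous_intros) auto
    then show "\<exists>C. \<forall>x\<in>{-1<..<1}. \<bar>poly ((pderiv ^^ j) p) x\<bar> \<le> C"
      unfolding bounded_iff by force
  qed (auto intro: poly_DERIV)
  then show ?thesis by simp
qed

text \<open>As a formal polynomial, \<open>jacobi\<close> has a degree and a leading coefficient,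
  and \<open>pderiv\<close> can be iterated on it.\<close>

definition jacobi_poly :: "real \<Rightarrow> real \<Rightarrow> nat \<Rightarrow> real poly" where
  "jacobi_poly a b n = (\<Sum>s\<le>n. smult (((real n + a) gchoose (n - s)) * ((real n + b) gchoose s))
     ([:- (1/2), 1/2:] ^ s * [:1/2, 1/2:] ^ (n - s)))"

lemma poly_jacobi_poly: "poly (jacobi_poly a b n) x = jacobi a b n x"
  unfolding jacobi_poly_def jacobi_def poly_sum
  by (intro sum.cong) (auto simp: field_simps)

lemma degree_jacobi_poly_factor:
  "s \<le> n \<Longrightarrow> degree ([:- (1/2), 1/2::real:] ^ s * [:1/2, 1/2:] ^ (n - s)) = n"
  by (simp add: degree_mult_eq degree_power_eq)

text \<open>The degree is at most n, so the n-th derivative is n! times the coefficient of x^n. Each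
  product of linear factors contributes (1/2)^n to it, and Vandermonde's convolution sums the
  binomials.\<close>

lemma higher_pderiv_jacobi_poly:
  "(pderiv ^^ n) (jacobi_poly a b n) = [:fact n * (1/2) ^ n * ((2 * real n + a + b) gchoose n):]"
proof -
  have deg: "degree (jacobi_poly a b n) \<le> n"
    unfolding jacobi_poly_def
    by (intro degree_sum_le order_trans[OF degree_smult_le]) (simp_all add: degree_jacobi_poly_factor)
  have lc: "coeff ([:- (1/2), 1/2::real:] ^ s * [:1/2, 1/2:] ^ (n - s)) n = (1/2) ^ n" if "s \<le> n" for s
  proof -
    have "coeff ([:- (1/2), 1/2::real:] ^ s * [:1/2, 1/2:] ^ (n - s)) n
        = lead_coeff ([:- (1/2), 1/2::real:] ^ s * [:1/2, 1/2:] ^ (n - s))"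
      using degree_jacobi_poly_factor[OF that] by simp
    also have "\<dots> = (1/2) ^ s * (1/2) ^ (n - s)"
      unfolding lead_coeff_mult lead_coeff_power by simp
    finally show ?thesis using that by (simp flip: power_add)
  qed
  have "coeff (jacobi_poly a b n) n = (\<Sum>s\<le>n. ((real n + b) gchoose s) * ((real n + a) gchoose (n - s))) * (1/2) ^ n"
    unfolding jacobi_poly_def coeff_sum sum_distrib_right by (intro sum.cong) (auto simp: lc)
  also have "(\<Sum>s\<le>n. ((real n + b) gchoose s) * ((real n + a) gchoose (n - s))) = ((2 * real n + a + b) gchoose n)"
    using gbinomial_Vandermonde[of "real n + b" "real n + a" n] by (simp add: atMost_atLeast0 algebra_simps)
  finally have "coeff (jacobi_poly a b n) n = (1/2) ^ n * ((2 * real n + a + b) gchoose n)"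
    by simp
  then show ?thesis
    using deg by (intro poly_eqI)
      (auto simp: coeff_higher_pderiv coeff_pCons coeff_eq_0 pochhammer_fact mult.assoc split: nat.splits)
qed

text \<open>After n integrations by parts only the weight with exponents a + n and b + n is left to
  integrate. This form also covers n = 0, where the usual expression by Gamma functions divides by 2
  n + a + b + 1, which can be 0.\<close>

lemma jacobi_sqnorm_eq:
  assumes "a > -1" "b > -1"
  shows "jacobi_sqnorm a b n = 2 powr (a + b + 1) * ((2 * real n + a + b) gchoose n)
           * Beta (real n + a + 1) (real n + b + 1)"
proof -
  let ?F = "\<lambda>j. poly ((pderiv ^^ j) (jacobi_poly a b n))"
  define c where "c = fact n * (1/2) ^ n * ((2 * real n + a + b) gchoose n)"
  have "jacobi_sqnorm a b n = integral {-1..1} (\<lambda>x. wjac a b n x * ?F 0 x)"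
    unfolding jacobi_sqnorm_def wjac_def by (simp add: poly_jacobi_poly power2_eq_square mult.assoc)
  also have "\<dots> = fact (n - n) / (2 ^ n * fact n) * integral {-1..1} (\<lambda>x. wjac (a + real n) (b + real n) (n - n) x * ?F n x)"
    by (rule integral_wjac_iterated_parts[OF symbol_poly]) (use assms in auto)
  also have "(\<lambda>x. wjac (a + real n) (b + real n) (n - n) x * ?F n x) = (\<lambda>x. c * jacobi_weight (a + real n) (b + real n) x)"
    unfolding higher_pderiv_jacobi_poly by (simp add: wjac_def jacobi_def c_def mult.commute)
  also have "integral {-1..1} \<dots> = c * (2 powr (a + real n + (b + real n) + 1) * Beta (a + real n + 1) (b + real n + 1))"
    using assms by (intro integral_unique has_integral_mult_right has_integral_jacobi_weight) auto
  also have "2 powr (a + real n + (b + real n) + 1) = 2 powr (a + b + 1) * 2 ^ n * (2::real) ^ n"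
    by (simp flip: powr_realpow powr_add add: algebra_simps)
  finally show ?thesis by (simp add: c_def power_one_over field_simps add_ac)
qed

section \<open>Asymptotics of the square norm through ratios of Gamma functions\<close>

text \<open>Euler's limit for Gamma: \<open>Gamma_series c n\<close> is n! n^c divided by a
  Pochhammer symbol, which in turn is Gamma (n + 1 + c) / Gamma c.\<close>

lemma Gamma_ratio_limit_pos:
  fixes c :: real assumes c: "c > 0"
  shows "(\<lambda>n. Gamma (real n + 1 + c) / (fact n * real n powr c)) \<longlonglongrightarrow> 1"
proof -
  have pos: "Gamma c > 0" using c by (rule Gamma_real_pos)
  have "(\<lambda>n. Gamma c / Gamma_series c n) \<longlonglongrightarrow> Gamma c / Gamma c"
    using pos by (intro tendsto_intros Gamma_series_LIMSEQ) auto
  then have "(\<lambda>n. Gamma c / Gamma_series c n) \<longlonglongrightarrow> 1" using pos by simp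
  moreover have "\<forall>\<^sub>F n in sequentially. Gamma c / Gamma_series c n = Gamma (real n + 1 + c) / (fact n * real n powr c)"
    using eventually_gt_at_top[of 0]
  proof eventually_elim
    case (elim n)
    have "pochhammer c (n + 1) = Gamma (c + real (n + 1)) / Gamma c"
      using c by (intro pochhammer_Gamma) auto
    then show ?case using elim pos by (simp add: Gamma_series_def powr_def field_simps add_ac)
  qed
  ultimately show ?thesis by (rule Lim_transform_eventually)
qed

text \<open>The range c > -2 is that of c = a + b for a, b > -1. Two uses of the functional equation
  reduce it to c + 2 > 0.\<close>

lemma Gamma_ratio_limit:
  fixes c :: real assumes c: "c > -2"
  shows "(\<lambda>n. Gamma (real n + 1 + c) / (fact n * real n powr c)) \<longlonglongrightarrow> 1"
proof -
  have "(\<lambda>n. Gamma (real n + 1 + (c + 2)) / (fact n * real n powr (c + 2)) * ((real n)\<^sup>2 / ((real n + 1 + c) * (real n + 2 + c)))) \<longlonglongrightarrow> 1 * 1"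
    using c by (intro tendsto_mult Gamma_ratio_limit_pos) (auto, real_asymp)
  moreover have "\<forall>\<^sub>F n in sequentially. Gamma (real n + 1 + (c + 2)) / (fact n * real n powr (c + 2)) * ((real n)\<^sup>2 / ((real n + 1 + c) * (real n + 2 + c)))
      = Gamma (real n + 1 + c) / (fact n * real n powr c)"
    using eventually_gt_at_top[of 0]
  proof eventually_elim
    case (elim n)
    then have p: "real n + 1 + c > 0" using c by linarith
    have "Gamma (real n + 1 + (c + 2)) = (real n + 2 + c) * Gamma (real n + 2 + c)"
      using Gamma_plus1[of "real n + 2 + c"] p by (simp add: add_ac nonpos_Ints_def)
    also have "Gamma (real n + 2 + c) = (real n + 1 + c) * Gamma (real n + 1 + c)"
      using Gamma_plus1[of "real n + 1 + c"] p by (simp add: add_ac nonpos_Ints_def)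
    finally have g: "Gamma (real n + 1 + (c + 2)) = (real n + 2 + c) * ((real n + 1 + c) * Gamma (real n + 1 + c))" .
    have "real n powr (c + 2) = real n powr c * (real n)\<^sup>2"
      using elim by (simp add: powr_add)
    moreover have "(v * (u * G)) / (F * (y * k)) * (k / (u * v)) = G / (F * y)"
      if "u \<noteq> 0" "v \<noteq> 0" "k \<noteq> 0" "F \<noteq> 0" "y \<noteq> 0" for u v k F y G :: real
      using that by (simp add: field_simps)
    ultimately show ?case unfolding g using p elim by simp
  qed
  ultimately show ?thesis by (simp add: Lim_transform_eventually)
qed

text \<open>Gamma (2 n + a + b + 1) cancels between the binomial and the Beta value. What remains
  are the ratios of \<open>Gamma_ratio_limit\<close> for a, b and a + b, whose powers of n cancel,
  and 1 / (2 n + a + b + 1).\<close>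

lemma jacobi_sqnorm_limit:
  assumes ab: "a > -1" "b > -1"
  shows "(\<lambda>n. real n * jacobi_sqnorm a b n) \<longlonglongrightarrow> 2 powr (a + b)"
proof -
  let ?R = "\<lambda>c n. Gamma (real n + 1 + c) / (fact n * real n powr c)"
  have half: "(\<lambda>n. real n / (2 * real n + a + b + 1)) \<longlonglongrightarrow> 1/2" by real_asymp
  have "(\<lambda>n. 2 powr (a + b + 1) * (?R a n * ?R b n / ?R (a + b) n) * (real n / (2 * real n + a + b + 1)))
     \<longlonglongrightarrow> 2 powr (a + b + 1) * (1 * 1 / 1) * (1/2)"
    using ab by (intro tendsto_mult tendsto_divide tendsto_const Gamma_ratio_limit half) auto
  also have "2 powr (a + b + 1) * (1 * 1 / 1) * (1/2) = 2 powr (a + b)" by (simp add: powr_add)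
  finally show ?thesis
  proof (rule Lim_transform_eventually)
    show "\<forall>\<^sub>F n in sequentially. 2 powr (a + b + 1) * (?R a n * ?R b n / ?R (a + b) n) * (real n / (2 * real n + a + b + 1))
        = real n * jacobi_sqnorm a b n"
      using eventually_gt_at_top[of 0]
    proof eventually_elim
      case (elim n)
      then have p: "real n + 1 + (a + b) > 0" using ab by linarith
      then have p2: "2 * real n + a + b + 1 > 0" by simp
      define G where "G = Gamma (2 * real n + a + b + 1)"
      have G: "G > 0" unfolding G_def using p2 by (rule Gamma_real_pos)
      have Gab: "Gamma (real n + 1 + (a + b)) > 0" using p by (rule Gamma_real_pos)
      have "pochhammer (real n + 1 + (a + b)) n = Gamma (real n + 1 + (a + b) + real n) / Gamma (real n + 1 + (a + b))"
        using p by (intro pochhammer_Gamma) (auto simp: nonpos_Ints_def)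
      then have g: "((2 * real n + a + b) gchoose n) = G / (Gamma (real n + 1 + (a + b)) * fact n)"
        unfolding gbinomial_pochhammer' G_def by (simp add: algebra_simps)
      have "Gamma (2 * real n + a + b + 2) = (2 * real n + a + b + 1) * G"
        unfolding G_def using Gamma_plus1[of "2 * real n + a + b + 1"] p2 by (simp add: add_ac nonpos_Ints_def)
      then have B: "Beta (real n + a + 1) (real n + b + 1) = Gamma (real n + 1 + a) * Gamma (real n + 1 + b) / ((2 * real n + a + b + 1) * G)"
        unfolding Beta_def by (simp add: algebra_simps)
      have cancel: "c * (x / (F * u) * (y / (F * v)) / (z / (F * (u * v)))) * (k / q) = k * (c * (G / (z * F)) * (x * y / (q * G)))"
        if "F \<noteq> 0" "u \<noteq> 0" "v \<noteq> 0" "z \<noteq> 0" "q \<noteq> 0" for c x y z F u v k q :: real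
        using that G by (simp add: field_simps)
      show ?case unfolding jacobi_sqnorm_eq[OF ab] g B powr_add[of "real n" a b]
        using G Gab p2 elim by (intro cancel) auto
    qed
  qed
qed

lemma inverse_jacobi_sqnorm_bigo:
  assumes ab: "a > -1" "b > -1"
  shows "(\<lambda>n. 1 / jacobi_sqnorm a b n) \<in> O(\<lambda>n. real n)"
proof -
  define L :: real where "L = 2 powr (a + b)"
  have L: "L > 0" by (simp add: L_def)
  have ev: "\<forall>\<^sub>F n in sequentially. real n * jacobi_sqnorm a b n > L / 2"
    using jacobi_sqnorm_limit[OF ab] by (rule order_tendstoD) (simp add: L_def)
  show ?thesis
  proof (intro bigoI[of _ "2 / L"], use ev eventually_gt_at_top[of 0] in eventually_elim)
    case (elim n)
    have "real n * jacobi_sqnorm a b n > 0" using elim L by linarith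
    then have "jacobi_sqnorm a b n > 0" using elim by (simp add: zero_less_mult_iff)
    then show ?case using elim L by (simp add: field_simps)
  qed
qed

section \<open>Products of powers and logarithms\<close>

text \<open>The coefficient of z ^ i in the product of d - j + z over j < n.\<close>
primrec powr_ln_coeff :: "real \<Rightarrow> nat \<Rightarrow> nat \<Rightarrow> real" where
  "powr_ln_coeff d 0 = (\<lambda>i. if i = 0 then 1 else 0)"
| "powr_ln_coeff d (Suc n) = (\<lambda>i. (d - real n) * powr_ln_coeff d n i + (if i = 0 then 0 else powr_ln_coeff d n (i - 1)))"

text \<open>This is the coefficient of z^m in the j-th derivative of (1 + x) powr (d + z). With the
  factorials, differentiating a power of the logarithm shifts its index without an extra
  factor.\<close>

definition powr_ln :: "real \<Rightarrow> nat \<Rightarrow> nat \<Rightarrow> real \<Rightarrow> real" where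
  "powr_ln d m j x = (1 + x) powr (d - real j) * (\<Sum>i\<le>m. powr_ln_coeff d j i * (ln (1 + x) ^ (m - i) / fact (m - i)))"

lemma powr_ln_0: "powr_ln d m 0 x = (1 + x) powr d * (ln (1 + x) ^ m / fact m)"
proof -
  have "(\<Sum>i\<le>m. powr_ln_coeff d 0 i * (ln (1 + x) ^ (m - i) / fact (m - i)))
      = (\<Sum>i\<le>m. if i = 0 then ln (1 + x) ^ m / fact m else 0)"
    by (intro sum.cong) auto
  then show ?thesis by (simp add: powr_ln_def)
qed

lemma powr_ln_has_derivative:
  assumes x: "x > -1"
  shows "(powr_ln d m j has_real_derivative powr_ln d m (Suc j) x) (at x)"
proof -
  let ?L = "\<lambda>k. ln (1 + x) ^ k / fact k"
  define c where "c = powr_ln_coeff d j"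
  \<comment> \<open>The case k = 0 is separate because 0 - 1 is 0 in the natural numbers.\<close>
  define L' where "L' k = (if k = 0 then 0 else ?L (k - 1))" for k
  have dL: "((\<lambda>x. ln (1 + x) ^ k / fact k) has_real_derivative L' k / (1 + x)) (at x)" for k
  proof (cases k)
    case (Suc l)
    have "((\<lambda>x. ln (1 + x)) has_real_derivative 1 / (1 + x)) (at x)"
      using x by (auto intro!: derivative_eq_intros)
    from DERIV_cdivide[OF DERIV_power[OF this, of "Suc l"], of "fact (Suc l)"]
    moreover have "real (Suc l) * (1 / (1 + x) * ln (1 + x) ^ (Suc l - Suc 0)) / fact (Suc l) = ln (1 + x) ^ l / fact l / (1 + x)"
      using x by (simp add: divide_simps del: of_nat_Suc)
    ultimately show ?thesis unfolding Suc L'_def by (simp only:) simp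
  qed (simp add: L'_def)
  have dp: "((\<lambda>x. (1 + x) powr (d - real j)) has_real_derivative (d - real j) * (1 + x) powr (d - real (Suc j))) (at x)"
    using x by (auto intro!: derivative_eq_intros simp: algebra_simps)
  have "((\<lambda>x. (1 + x) powr (d - real j) * (\<Sum>i\<le>m. c i * (ln (1 + x) ^ (m - i) / fact (m - i)))) has_real_derivative
      (d - real j) * (1 + x) powr (d - real (Suc j)) * (\<Sum>i\<le>m. c i * ?L (m - i))
      + (\<Sum>i\<le>m. c i * (L' (m - i) / (1 + x))) * (1 + x) powr (d - real j)) (at x)"
    by (intro DERIV_mult dp DERIV_sum DERIV_cmult dL)
  also have "(1 + x) powr (d - real j) = (1 + x) powr (d - real (Suc j)) * (1 + x)"
    using x powr_add[of "1 + x" "d - real (Suc j)" 1] by (simp add: algebra_simps)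
  also have "(\<Sum>i\<le>m. c i * (L' (m - i) / (1 + x))) * ((1 + x) powr (d - real (Suc j)) * (1 + x))
      = (1 + x) powr (d - real (Suc j)) * (\<Sum>i\<le>m. c i * L' (m - i))"
    using x by (simp add: sum_distrib_left sum_distrib_right mult_ac)
  \<comment> \<open>Differentiating the logarithm moves a coefficient from i to i + 1, the second
    summand in the recursion of \<open>powr_ln_coeff\<close>. At i = m the power of the logarithm is
    constant and contributes 0.\<close>
  also have "(\<Sum>i\<le>m. c i * L' (m - i)) = (\<Sum>i\<le>m. (if i = 0 then 0 else c (i - 1)) * ?L (m - i))"
  proof (cases m)
    case (Suc l)
    have "(\<Sum>i\<le>Suc l. c i * L' (Suc l - i)) = (\<Sum>i\<le>l. c i * L' (Suc l - i))"
      by (simp add: L'_def)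
    also have "\<dots> = (\<Sum>i\<le>l. c i * ?L (l - i))"
      by (intro sum.cong) (auto simp: L'_def Suc_diff_le)
    also have "\<dots> = (\<Sum>i\<le>Suc l. (if i = 0 then 0 else c (i - 1)) * ?L (Suc l - i))"
      by (simp only: sum.atMost_Suc_shift) simp
    finally show ?thesis unfolding Suc .
  qed (simp add: L'_def)
  also have "(d - real j) * (1 + x) powr (d - real (Suc j)) * (\<Sum>i\<le>m. c i * ?L (m - i)) +
      (1 + x) powr (d - real (Suc j)) * (\<Sum>i\<le>m. (if i = 0 then 0 else c (i - 1)) * ?L (m - i)) = powr_ln d m (Suc j) x"
    unfolding powr_ln_def c_def powr_ln_coeff.simps
    by (simp add: sum_distrib_left sum.distrib distrib_left distrib_right mult_ac del: of_nat_Suc)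
  finally show ?thesis unfolding powr_ln_def[abs_def] c_def .
qed

text \<open>Cauchy's estimate: the right side is a polynomial in r whose nonnegative coefficients
  dominate the absolute values on the left, and one term is at most the whole.\<close>

lemma powr_ln_coeff_bound:
  assumes r: "r \<ge> 0"
  shows "\<bar>powr_ln_coeff d n i\<bar> * r ^ i \<le> (\<Prod>j<n. \<bar>d - real j\<bar> + r)"
proof (induction n arbitrary: i)
  case (Suc n)
  have "\<bar>powr_ln_coeff d (Suc n) i\<bar> * r ^ i \<le> \<bar>d - real n\<bar> * (\<bar>powr_ln_coeff d n i\<bar> * r ^ i)
      + r * (if i = 0 then 0 else \<bar>powr_ln_coeff d n (i - 1)\<bar> * r ^ (i - 1))"
  proof -
    have "\<bar>powr_ln_coeff d (Suc n) i\<bar> * r ^ i \<le> (\<bar>(d - real n) * powr_ln_coeff d n i\<bar> + \<bar>if i = 0 then 0 else powr_ln_coeff d n (i - 1)\<bar>) * r ^ i"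
      using r unfolding powr_ln_coeff.simps by (intro mult_right_mono abs_triangle_ineq) auto
    also have "\<dots> = \<bar>d - real n\<bar> * (\<bar>powr_ln_coeff d n i\<bar> * r ^ i)
      + r * (if i = 0 then 0 else \<bar>powr_ln_coeff d n (i - 1)\<bar> * r ^ (i - 1))"
      by (cases i) (auto simp: abs_mult distrib_right distrib_left mult_ac)
    finally show ?thesis .
  qed
  also have "\<dots> \<le> \<bar>d - real n\<bar> * (\<Prod>j<n. \<bar>d - real j\<bar> + r) + r * (\<Prod>j<n. \<bar>d - real j\<bar> + r)"
  proof (intro add_mono mult_left_mono Suc)
    have "0 \<le> (\<Prod>j<n. \<bar>d - real j\<bar> + r)" using r by (intro prod_nonneg) auto
    then show "(if i = 0 then 0 else \<bar>powr_ln_coeff d n (i - 1)\<bar> * r ^ (i - 1)) \<le> (\<Prod>j<n. \<bar>d - real j\<bar> + r)"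
      using Suc by auto
  qed (use r in auto)
  finally show ?case by (simp add: algebra_simps)
qed auto

text \<open>One term of the exponential series of r |ln u| is at most its sum. The sum is u^(-r) for
  u <= 1, and it is u^r = u^(2 r) u^(-r) <= 4^r u^(-r) for 1 < u <= 2.\<close>

lemma ln_power_bound:
  fixes r u :: real
  assumes r: "r > 0" and u: "0 < u" "u \<le> 2"
  shows "\<bar>ln u\<bar> ^ k / fact k \<le> (1 / r) ^ k * (4 powr r * u powr (- r))"
proof -
  have "(r * \<bar>ln u\<bar>) ^ k / fact k \<le> exp (r * \<bar>ln u\<bar>)"
  proof -
    have "sum (\<lambda>i. (r * \<bar>ln u\<bar>) ^ i /\<^sub>R fact i) {k} \<le> suminf (\<lambda>i. (r * \<bar>ln u\<bar>) ^ i /\<^sub>R fact i)"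
      by (rule sum_le_suminf[OF summable_exp_generic]) (use r in auto)
    then show ?thesis by (simp add: exp_def divide_inverse mult.commute real_scaleR_def)
  qed
  also have "\<dots> \<le> 4 powr r * u powr (- r)"
  proof (cases "u \<le> 1")
    case True
    then have "exp (r * \<bar>ln u\<bar>) = 1 * u powr (- r)" using u by (simp add: powr_def)
    also have "\<dots> \<le> 4 powr r * u powr (- r)" using r by (intro mult_right_mono ge_one_powr_ge_zero) auto
    finally show ?thesis .
  next
    case False
    then have "exp (r * \<bar>ln u\<bar>) = (u * u) powr r * u powr (- r)"
      using u by (simp add: powr_mult powr_minus) (simp add: powr_def)
    also have "\<dots> \<le> 4 powr r * u powr (- r)"
      using r u mult_mono[of u 2 u 2] by (intro mult_right_mono powr_mono2) auto
    finally show ?thesis .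
  qed
  finally have "(1 / r) ^ k * ((r * \<bar>ln u\<bar>) ^ k / fact k) \<le> (1 / r) ^ k * (4 powr r * u powr (- r))"
    using r by (intro mult_left_mono) auto
  then show ?thesis using r by (simp add: power_mult_distrib power_one_over)
qed

text \<open>The powers (1 / r)^i from the coefficient and (1 / r)^(m - i) from the logarithm combine
  to (1 / r)^m, so all m + 1 summands share one bound.\<close>

lemma powr_ln_bound:
  assumes r: "r > 0" and x: "x \<in> {-1<..1}"
  shows "\<bar>powr_ln d m j x\<bar> \<le> real (Suc m) * 4 powr r * (1 / r) ^ m * (\<Prod>l<j. \<bar>d - real l\<bar> + r)
           * (1 + x) powr (d - r - real j)"
proof -
  let ?Q = "\<Prod>l<j. \<bar>d - real l\<bar> + r"
  have Q: "?Q \<ge> 0" using r by (intro prod_nonneg) auto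
  have "\<bar>\<Sum>i\<le>m. powr_ln_coeff d j i * (ln (1 + x) ^ (m - i) / fact (m - i))\<bar>
      \<le> (\<Sum>i\<le>m. \<bar>powr_ln_coeff d j i * (ln (1 + x) ^ (m - i) / fact (m - i))\<bar>)" by (rule sum_abs)
  also have "\<dots> \<le> (\<Sum>i\<le>m. ?Q * (1 / r) ^ m * (4 powr r * (1 + x) powr (- r)))"
  proof (rule sum_mono)
    fix i assume i: "i \<in> {..m}"
    have "\<bar>powr_ln_coeff d j i\<bar> \<le> ?Q * (1 / r) ^ i"
      using powr_ln_coeff_bound[of r d j i] r by (simp add: field_simps)
    then have "\<bar>powr_ln_coeff d j i\<bar> * (\<bar>ln (1 + x)\<bar> ^ (m - i) / fact (m - i))
       \<le> ?Q * (1 / r) ^ i * ((1 / r) ^ (m - i) * (4 powr r * (1 + x) powr (- r)))"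
      using Q r x by (intro mult_mono ln_power_bound) auto
    also have "\<dots> = ?Q * ((1 / r) ^ i * (1 / r) ^ (m - i)) * (4 powr r * (1 + x) powr (- r))"
      by (simp only: mult_ac)
    also have "(1 / r) ^ i * (1 / r) ^ (m - i) = (1 / r) ^ m"
      using i by (simp flip: power_add)
    finally show "\<bar>powr_ln_coeff d j i * (ln (1 + x) ^ (m - i) / fact (m - i))\<bar> \<le> ?Q * (1 / r) ^ m * (4 powr r * (1 + x) powr (- r))"
      by (simp add: abs_mult power_abs)
  qed
  also have "\<dots> = real (Suc m) * 4 powr r * (1 / r) ^ m * ?Q * (1 + x) powr (- r)"
    by simp
  finally have "(1 + x) powr (d - real j) * \<bar>\<Sum>i\<le>m. powr_ln_coeff d j i * (ln (1 + x) ^ (m - i) / fact (m - i))\<bar>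
      \<le> (1 + x) powr (d - real j) * (real (Suc m) * 4 powr r * (1 / r) ^ m * ?Q * (1 + x) powr (- r))"
    by (intro mult_left_mono) auto
  moreover have "(1 + x) powr (d - r - real j) = (1 + x) powr (d - real j) * (1 + x) powr (- r)"
    by (simp flip: powr_add add: algebra_simps)
  ultimately show ?thesis unfolding powr_ln_def abs_mult by (simp add: mult_ac)
qed

lemma symbol_powr_ln:
  assumes "r > 0" shows "symbol (powr_ln d m) (d - r)"
  unfolding symbol_def
proof (intro allI conjI)
  fix j
  show "\<forall>x\<in>{-1<..<1}. (powr_ln d m j has_real_derivative powr_ln d m (Suc j) x) (at x)"
    by (auto intro: powr_ln_has_derivative)
  show "\<exists>C. \<forall>x\<in>{-1<..<1}. \<bar>powr_ln d m j x\<bar> \<le> C * (1 + x) powr (d - r - real j)"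
    using powr_ln_bound[OF assms, of _ d m j]
    by (intro exI[of _ "real (Suc m) * 4 powr r * (1 / r) ^ m * (\<Prod>l<j. \<bar>d - real l\<bar> + r)"] ballI) auto
qed

text \<open>After n integrations by parts the Jacobi polynomial has degree 0. The weight exponent b
  + n meets the bound (1 + x)^(d - r - n), which leaves a Beta integral; 1 / n! is distributed over
  the product. The bound is explicit in r because r will vary with n.\<close>

lemma integral_powr_ln_bound:
  assumes ab: "a > -1" "b > -1" and r: "r > 0" "b + d - r > -1"
  shows "\<bar>integral {-1..1} (\<lambda>x. wjac a b n x * powr_ln d m 0 x)\<bar>
     \<le> real (Suc m) * 4 powr r * (1 / r) ^ m * (\<Prod>j<n. (\<bar>d - real j\<bar> + r) / (real j + 1))
        * (2 powr (a + b + d - r + 1) * Beta (a + 1 + real n) (b + d + 1 - r))"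
proof -
  define K where "K = real (Suc m) * 4 powr r * (1 / r) ^ m * (\<Prod>l<n. \<bar>d - real l\<bar> + r)"
  have s: "symbol (powr_ln d m) (d - r)" using r by (intro symbol_powr_ln)
  let ?f = "\<lambda>x. wjac (a + real n) (b + real n) 0 x * powr_ln d m n x"
  have e: "integral {-1..1} (\<lambda>x. wjac a b n x * powr_ln d m 0 x)
     = fact (n - n) / (2 ^ n * fact n) * integral {-1..1} (\<lambda>x. wjac (a + real n) (b + real n) (n - n) x * powr_ln d m n x)"
    by (rule integral_wjac_iterated_parts[OF s]) (use ab r in auto)
  have hw: "((\<lambda>x. K * jacobi_weight (a + real n) (b + d - r) x) has_integral
       K * (2 powr (a + real n + (b + d - r) + 1) * Beta (a + real n + 1) (b + d - r + 1))) {-1..1}"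
    using ab r by (intro has_integral_mult_right has_integral_jacobi_weight) auto
  have "norm (integral {-1..1} ?f) \<le> integral {-1..1} (\<lambda>x. K * jacobi_weight (a + real n) (b + d - r) x)"
  proof (rule integral_norm_bound_integral)
    have sn: "symbol (\<lambda>j. powr_ln d m (n + j)) (d - r - real n)"
    proof (induction n)
      case (Suc n)
      from symbol_shift[OF this] show ?case by (simp add: algebra_simps)
    qed (use s in simp)
    show "?f integrable_on {-1..1}"
      using wjac_symbol_integrable[OF sn, of "a + real n" "b + real n" 0] ab r by simp
    show "(\<lambda>x. K * jacobi_weight (a + real n) (b + d - r) x) integrable_on {-1..1}"
      using hw by blast
    fix x :: real assume x: "x \<in> {-1..1}"
    show "norm (?f x) \<le> K * jacobi_weight (a + real n) (b + d - r) x"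
    proof (cases "x = -1")
      case False
      then have "\<bar>powr_ln d m n x\<bar> \<le> K * (1 + x) powr (d - r - real n)"
        unfolding K_def using x r by (intro powr_ln_bound) auto
      then have "jacobi_weight (a + real n) (b + real n) x * \<bar>powr_ln d m n x\<bar>
          \<le> jacobi_weight (a + real n) (b + real n) x * (K * (1 + x) powr (d - r - real n))"
        by (intro mult_left_mono) (auto simp: jacobi_weight_def)
      also have "\<dots> = K * ((1 - x) powr (a + real n) * ((1 + x) powr (b + real n) * (1 + x) powr (d - r - real n)))"
        by (simp add: jacobi_weight_def)
      also have "(1 + x) powr (b + real n) * (1 + x) powr (d - r - real n) = (1 + x) powr (b + d - r)"
        by (simp flip: powr_add add: algebra_simps)
      finally show ?thesis by (simp add: wjac_def jacobi_def abs_mult jacobi_weight_def)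
    qed (simp add: wjac_def jacobi_weight_def)
  qed
  also have "\<dots> = K * (2 powr (a + real n + (b + d - r) + 1) * Beta (a + real n + 1) (b + d - r + 1))"
    using hw by (rule integral_unique)
  also have "\<dots> = 2 ^ n * (K * (2 powr (a + b + d - r + 1) * Beta (a + 1 + real n) (b + d + 1 - r)))"
  proof -
    have "2 powr (a + real n + (b + d - r) + 1) = 2 ^ n * 2 powr (a + b + d - r + 1)"
      by (simp flip: powr_realpow powr_add add: algebra_simps)
    then show ?thesis by (simp add: algebra_simps)
  qed
  finally have "1 / (2 ^ n * fact n) * \<bar>integral {-1..1} ?f\<bar> \<le> 1 / (2 ^ n * fact n) * \<dots>"
    by (intro mult_left_mono) auto
  also have "\<dots> = K / fact n * (2 powr (a + b + d - r + 1) * Beta (a + 1 + real n) (b + d + 1 - r))"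
    by simp
  also have "K / fact n = real (Suc m) * 4 powr r * (1 / r) ^ m * (\<Prod>j<n. (\<bar>d - real j\<bar> + r) / (real j + 1))"
    unfolding K_def fact_prod_Suc by (simp add: prod_dividef atLeast0LessThan add.commute)
  finally show ?thesis unfolding e by (simp add: abs_mult)
qed

section \<open>Growth of the Beta values and of the products, uniformly in the parameter\<close>

lemma sum_inverse_ge_ln:
  assumes A: "A > 0"
  obtains C where "\<And>n. n \<ge> 1 \<Longrightarrow> (\<Sum>j<n. 1 / (A + real j)) \<ge> ln (real n) - C"
proof
  \<comment> \<open>Since A <= J + 1, the sum dominates a stretch of the harmonic series that starts
    after J terms; C is \<open>harm J\<close>.\<close>
  define J where "J = nat \<lceil>A\<rceil>"
  fix n :: nat assume n: "n \<ge> 1"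
  have J: "A \<le> real J + 1" unfolding J_def by linarith
  have "ln (real n) \<le> ln (real (n + J) + 1)" using n by simp
  also have "\<dots> \<le> harm (n + J)" by (rule ln_le_harm)
  also have "\<dots> = harm J + (\<Sum>j<n. 1 / (real J + 1 + real j))"
    by (induction n) (simp_all add: harm_Suc divide_inverse add_ac)
  also have "\<dots> \<le> harm J + (\<Sum>j<n. 1 / (A + real j))"
    using J A by (intro add_left_mono sum_mono divide_left_mono) (auto intro!: mult_pos_pos)
  finally show "(\<Sum>j<n. 1 / (A + real j)) \<ge> ln (real n) - harm J" by simp
qed

text \<open>The constant is uniform in the exponent because
  Beta (a + n) z = Beta a z times the product of 1 - z / (a + z + j) over j < n.\<close>
lemma Beta_upper_bound:
  fixes a c :: real
  assumes a: "a > 0" and c: "c > 0"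
  obtains C where "C \<ge> 0"
    "\<And>n z. n \<ge> 1 \<Longrightarrow> c / 2 \<le> z \<Longrightarrow> z \<le> c \<Longrightarrow> Beta (a + real n) z \<le> C * real n powr (- z)"
proof -
  obtain K where K: "\<And>n. n \<ge> 1 \<Longrightarrow> (\<Sum>j<n. 1 / (a + c + real j)) \<ge> ln (real n) - K"
    using sum_inverse_ge_ln[of "a + c"] a c by auto
  have B: "Beta (a + real n) z \<le> Beta a z * exp (- z * (\<Sum>j<n. 1 / (a + c + real j)))"
    if "0 < z" "z \<le> c" for n z
  proof (induction n)
    case (Suc n)
    have pos: "Beta a z \<ge> 0" using that a by (simp add: Beta_def Gamma_real_pos less_imp_le)
    have "Beta (a + real (Suc n)) z = (1 - z / (a + real n + z)) * Beta (a + real n) z"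
      using Beta_plus1_left[of "a + real n" z] a that
      by (simp add: field_simps add_ac nonpos_Ints_def)
    also have "\<dots> \<le> exp (- (z / (a + c + real n))) * Beta (a + real n) z"
    proof (rule mult_right_mono)
      \<comment> \<open>Enlarging z to c in the denominator makes the sum in the exponent
        independent of z.\<close>
      have "z / (a + c + real n) \<le> z / (a + real n + z)"
        using that a by (intro divide_left_mono mult_pos_pos) auto
      then have "1 - z / (a + real n + z) \<le> 1 + (- (z / (a + c + real n)))" by simp
      also have "\<dots> \<le> exp (- (z / (a + c + real n)))" by (rule exp_ge_add_one_self)
      finally show "1 - z / (a + real n + z) \<le> exp (- (z / (a + c + real n)))" .
      show "Beta (a + real n) z \<ge> 0" using that a by (simp add: Beta_def Gamma_real_pos less_imp_le)
    qed
    also have "\<dots> \<le> exp (- (z / (a + c + real n))) * (Beta a z * exp (- z * (\<Sum>j<n. 1 / (a + c + real j))))"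
      by (intro mult_left_mono Suc) auto
    also have "\<dots> = Beta a z * exp (- z * (\<Sum>j<Suc n. 1 / (a + c + real j)))"
      by (simp add: algebra_simps flip: exp_add)
    finally show ?case .
  qed simp
  show ?thesis
  proof (rule that)
    show "Beta a (c/2) * exp (c * \<bar>K\<bar>) \<ge> 0" using a c by (simp add: Beta_def Gamma_real_pos less_imp_le)
    fix n :: nat and z assume n: "n \<ge> 1" and z: "c / 2 \<le> z" "z \<le> c"
    have "Beta (a + real n) z \<le> Beta a z * exp (- z * (\<Sum>j<n. 1 / (a + c + real j)))"
      using z c by (intro B) auto
    \<comment> \<open>z >= c / 2 keeps \<open>Beta a z\<close> away from the pole at 0, and z <= c
      bounds the cost of replacing the sum by ln n.\<close>
    also have "\<dots> \<le> Beta a (c/2) * exp (- z * ln (real n) + c * \<bar>K\<bar>)"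
    proof (intro mult_mono)
      show "Beta a z \<le> Beta a (c/2)" using a c z by (intro Beta_real_mono) auto
      have "z * (ln (real n) - K) \<le> z * (\<Sum>j<n. 1 / (a + c + real j))"
        using K[OF n] z c by (intro mult_left_mono) auto
      moreover have "z * K \<le> z * \<bar>K\<bar>" "z * \<bar>K\<bar> \<le> c * \<bar>K\<bar>" using z c by (auto intro: mult_left_mono mult_right_mono)
      ultimately show "exp (- z * (\<Sum>j<n. 1 / (a + c + real j))) \<le> exp (- z * ln (real n) + c * \<bar>K\<bar>)"
        by (simp add: algebra_simps)
      show "0 \<le> Beta a (c/2)" using a c by (simp add: Beta_def Gamma_real_pos less_imp_le)
    qed auto
    also have "exp (- z * ln (real n) + c * \<bar>K\<bar>) = exp (c * \<bar>K\<bar>) * real n powr (- z)"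
      unfolding exp_add using n by (simp add: powr_def)
    finally show "Beta (a + real n) z \<le> Beta a (c/2) * exp (c * \<bar>K\<bar>) * real n powr (- z)"
      by (simp only: mult.assoc)
  qed
qed

lemma harmonic_tail_bound:
  obtains K :: real where "K \<ge> 0" "\<And>n. n \<ge> 1 \<Longrightarrow> \<bar>(\<Sum>j\<in>{J..<n}. 1 / (real j + 1)) - ln (real n)\<bar> \<le> K"
proof -
  have "Bseq (\<lambda>n. harm n - ln (real n))"
    using euler_mascheroni_convergent by (rule convergent_imp_Bseq)
  then obtain M where M: "M > 0" "\<And>n. \<bar>harm n - ln (real n)\<bar> \<le> M" unfolding Bseq_def by auto
  have h: "harm n = (\<Sum>j\<in>{0..<n}. 1 / (real j + 1))" for n
    unfolding harm_altdef by (simp add: atLeast0LessThan divide_inverse add.commute)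
  show ?thesis
  proof (rule that)
    show "M + harm J \<ge> 0" using M harm_nonneg[of J, where ?'a = real] by simp
    fix n :: nat
    show "\<bar>(\<Sum>j\<in>{J..<n}. 1 / (real j + 1)) - ln (real n)\<bar> \<le> M + harm J"
    proof (cases "J \<le> n")
      case True
      then have "(\<Sum>j\<in>{J..<n}. 1 / (real j + 1)) = harm n - harm J"
        unfolding h using sum.atLeastLessThan_concat[of 0 J n "\<lambda>j. 1 / (real j + 1)"] by simp
      then show ?thesis using M(2)[of n] harm_nonneg[of J, where ?'a = real] by (simp add: abs_le_iff)
    next
      \<comment> \<open>The sum is empty here, and ln n is within M of \<open>harm n\<close>, which
        is at most \<open>harm J\<close>.\<close>
      case False
      then have "harm n \<le> (harm J :: real)" by (intro harm_mono) auto
      then show ?thesis using False M(2)[of n] harm_nonneg[of n, where ?'a = real] by (simp add: abs_le_iff)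
    qed
  qed
qed

text \<open>For natural d the factor with j = d equals 1 / ln n up to a constant;
  this is the logarithm gained when the exponent is a nonnegative integer.\<close>
lemma prod_shifted_bound:
  assumes e: "e = 0 \<or> (e = 1 \<and> d \<in> \<nat>)"
  obtains C where "C \<ge> 0"
    "\<forall>\<^sub>F n in sequentially. (\<Prod>j<n. (\<bar>d - real j\<bar> + 1 / ln (real n)) / (real j + 1))
        \<le> C * real n powr (- d - 1) * (1 / ln (real n)) ^ e"
proof -
  \<comment> \<open>From J on, |d - j| is j - d; if d is natural, its index lies below J.\<close>
  define J where "J = Suc (nat \<lceil>\<bar>d\<bar>\<rceil>)"
  have J: "\<bar>d\<bar> < real J" unfolding J_def by linarith
  obtain K where K: "K \<ge> 0" "\<And>n. n \<ge> 1 \<Longrightarrow> \<bar>(\<Sum>j\<in>{J..<n}. 1 / (real j + 1)) - ln (real n)\<bar> \<le> K"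
    using harmonic_tail_bound[of J] by blast
  \<comment> \<open>The summand 1 pays for r ln n = 1, the other one for replacing the harmonic tail
    by ln n.\<close>
  define E where "E = exp (1 + (\<bar>d\<bar> + 2) * K)"
  have "\<exists>A\<ge>0. \<forall>r. 0 \<le> r \<longrightarrow> r \<le> 1 \<longrightarrow> (\<Prod>j<J. (\<bar>d - real j\<bar> + r) / (real j + 1)) \<le> A * r ^ e"
    using e
  proof
    assume "e = 0"
    then show ?thesis
      by (intro exI[of _ "\<Prod>j<J. (\<bar>d - real j\<bar> + 1) / (real j + 1)"])
         (auto intro!: prod_mono prod_nonneg divide_right_mono)
  next
    assume *: "e = 1 \<and> d \<in> \<nat>"
    then obtain p where p: "d = real p" by (auto elim: Nats_cases)
    have pJ: "p \<in> {..<J}" using J p by auto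
    show ?thesis
    proof (intro exI[of _ "\<Prod>j\<in>{..<J}-{p}. (\<bar>d - real j\<bar> + 1) / (real j + 1)"] conjI allI impI)
      fix r :: real assume r: "0 \<le> r" "r \<le> 1"
      have "(\<Prod>j<J. (\<bar>d - real j\<bar> + r) / (real j + 1))
          = r / (real p + 1) * (\<Prod>j\<in>{..<J}-{p}. (\<bar>d - real j\<bar> + r) / (real j + 1))"
        using prod.remove[OF _ pJ, of "\<lambda>j. (\<bar>d - real j\<bar> + r) / (real j + 1)"] p by simp
      \<comment> \<open>The factor at p is r / (p + 1) <= r; the others are at most their values at
        r = 1.\<close>
      also have "\<dots> \<le> r * (\<Prod>j\<in>{..<J}-{p}. (\<bar>d - real j\<bar> + 1) / (real j + 1))"
        using r by (intro mult_mono prod_mono) (auto intro!: divide_right_mono prod_nonneg simp: divide_le_eq mult_le_cancel_left1)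
      finally show "(\<Prod>j<J. (\<bar>d - real j\<bar> + r) / (real j + 1))
          \<le> (\<Prod>j\<in>{..<J}-{p}. (\<bar>d - real j\<bar> + 1) / (real j + 1)) * r ^ e"
        using * by (simp add: mult.commute)
    qed (auto intro!: prod_nonneg)
  qed
  then obtain A where A: "A \<ge> 0"
    "\<And>r. 0 \<le> r \<Longrightarrow> r \<le> 1 \<Longrightarrow> (\<Prod>j<J. (\<bar>d - real j\<bar> + r) / (real j + 1)) \<le> A * r ^ e"
    by blast
  have "(\<lambda>n. 1 / ln (real n)) \<longlonglongrightarrow> 0" by real_asymp
  then have "\<forall>\<^sub>F n in sequentially. 1 / ln (real n) < 1" by (rule order_tendstoD) auto
  moreover have "\<forall>\<^sub>F n in sequentially. n \<ge> max 3 J" by (rule eventually_ge_at_top)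
  ultimately have ev: "\<forall>\<^sub>F n in sequentially. (\<Prod>j<n. (\<bar>d - real j\<bar> + 1 / ln (real n)) / (real j + 1))
        \<le> (A * E) * real n powr (- d - 1) * (1 / ln (real n)) ^ e"
  proof eventually_elim
    case (elim n)
    define r where "r = 1 / ln (real n)"
    have n: "n \<ge> 3" "n \<ge> J" using elim by auto
    have ln: "ln (real n) > 0" using n by simp
    have r: "0 < r" "r \<le> 1" using ln elim unfolding r_def by auto
    define S where "S = (\<Sum>j\<in>{J..<n}. 1 / (real j + 1))"
    have S: "\<bar>S - ln (real n)\<bar> \<le> K" unfolding S_def using K n by simp
    have "(\<Prod>j\<in>{J..<n}. (\<bar>d - real j\<bar> + r) / (real j + 1)) \<le> (\<Prod>j\<in>{J..<n}. exp (- (d + 1 - r) * (1 / (real j + 1))))"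
    proof (intro prod_mono conjI)
      fix j assume j: "j \<in> {J..<n}"
      then have "\<bar>d - real j\<bar> = real j - d" using J by auto
      \<comment> \<open>In this form 1 + t <= exp t applies, and the exponents add up to a multiple
        of the harmonic tail.\<close>
      then have "(\<bar>d - real j\<bar> + r) / (real j + 1) = 1 + (- (d + 1 - r) * (1 / (real j + 1)))"
        by (simp add: field_simps)
      then show "(\<bar>d - real j\<bar> + r) / (real j + 1) \<le> exp (- (d + 1 - r) * (1 / (real j + 1)))"
        using exp_ge_add_one_self by metis
      show "0 \<le> (\<bar>d - real j\<bar> + r) / (real j + 1)" using r by auto
    qed
    also have "\<dots> = exp (- (d + 1 - r) * S)"
      unfolding S_def by (simp add: exp_sum sum_distrib_left)
    also have "\<dots> \<le> exp (- (d + 1) * ln (real n) + (1 + (\<bar>d\<bar> + 2) * K))"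
    proof -
      have "- (d + 1 - r) * S = - (d + 1) * ln (real n) + r * ln (real n) - (d + 1 - r) * (S - ln (real n))"
        by (simp add: algebra_simps)
      moreover have "r * ln (real n) = 1" using ln by (simp add: r_def)
      moreover have "\<bar>(d + 1 - r) * (S - ln (real n))\<bar> \<le> (\<bar>d\<bar> + 2) * K"
        unfolding abs_mult using r S by (intro mult_mono) auto
      ultimately have "- (d + 1 - r) * S \<le> - (d + 1) * ln (real n) + (1 + (\<bar>d\<bar> + 2) * K)"
        by linarith
      then show ?thesis by simp
    qed
    also have "\<dots> = E * real n powr (- d - 1)"
      unfolding exp_add E_def using n by (simp add: powr_def algebra_simps)
    finally have 2: "(\<Prod>j\<in>{J..<n}. (\<bar>d - real j\<bar> + r) / (real j + 1)) \<le> E * real n powr (- d - 1)" .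
    have "(\<Prod>j<n. (\<bar>d - real j\<bar> + r) / (real j + 1))
        = (\<Prod>j<J. (\<bar>d - real j\<bar> + r) / (real j + 1)) * (\<Prod>j\<in>{J..<n}. (\<bar>d - real j\<bar> + r) / (real j + 1))"
      using prod.atLeastLessThan_concat[of 0 J n "\<lambda>j. (\<bar>d - real j\<bar> + r) / (real j + 1)"] n
      by (simp add: atLeast0LessThan)
    also have "\<dots> \<le> (A * r ^ e) * (E * real n powr (- d - 1))"
      using A r 2 by (intro mult_mono) (auto intro!: prod_nonneg)
    finally show ?case unfolding r_def by (simp add: mult_ac)
  qed
  show ?thesis by (rule that[OF _ ev]) (use A in \<open>auto simp: E_def\<close>)
qed

text \<open>With r = 1 / ln n the product is O(n^(-d-1) (ln n)^(-e)), the Beta value is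
  O(n^(-b-d-1)) because n^r = exp 1, and (1 / r)^m is (ln n)^m.\<close>

lemma integral_powr_ln_bigo:
  assumes ab: "a > -1" "b > -1" "b + d > -1" and e: "e = 0 \<or> (e = 1 \<and> d \<in> \<nat>)" "e \<le> m"
  shows "(\<lambda>n. integral {-1..1} (\<lambda>x. wjac a b n x * powr_ln d m 0 x))
     \<in> O(\<lambda>n. real n powr (- b - 2 * d - 2) * ln (real n) ^ (m - e))"
proof -
  define c where "c = b + d + 1"
  have c: "c > 0" using ab by (simp add: c_def)
  obtain A where A: "A \<ge> 0" "\<forall>\<^sub>F n in sequentially. (\<Prod>j<n. (\<bar>d - real j\<bar> + 1 / ln (real n)) / (real j + 1))
        \<le> A * real n powr (- d - 1) * (1 / ln (real n)) ^ e"
    by (rule prod_shifted_bound[OF e(1)])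
  have a: "a + 1 > 0" using ab by simp
  obtain B where B: "B \<ge> 0" "\<And>n z. n \<ge> 1 \<Longrightarrow> c / 2 \<le> z \<Longrightarrow> z \<le> c \<Longrightarrow> Beta (a + 1 + real n) z \<le> B * real n powr (- z)"
    using Beta_upper_bound[OF a c] by blast
  define M where "M = real (Suc m) * 4 * A * (2 powr (a + b + d + 1) * (B * exp 1))"
  have "(\<lambda>n. 1 / ln (real n)) \<longlonglongrightarrow> 0" by real_asymp
  \<comment> \<open>r < c / 2 places the Beta argument c - r between c / 2 and c, where
    \<open>Beta_upper_bound\<close> is uniform.\<close>
  then have ev: "\<forall>\<^sub>F n in sequentially. 1 / ln (real n) < min 1 (c / 2)" using c by (intro order_tendstoD) auto
  show ?thesis
  proof (intro bigoI[of _ M], use ev A(2) eventually_ge_at_top[of 3] in eventually_elim)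
    case (elim n)
    define r where "r = 1 / ln (real n)"
    define Q where "Q = (\<Prod>j<n. (\<bar>d - real j\<bar> + r) / (real j + 1))"
    have ln: "ln (real n) > 0" using elim by simp
    have r: "0 < r" "r \<le> 1" "r \<le> c / 2" using ln elim unfolding r_def by auto
    have Q: "Q \<le> A * real n powr (- d - 1) * r ^ e" "Q \<ge> 0"
      unfolding Q_def using elim r by (auto intro!: prod_nonneg simp: r_def)
    have lnm: "(1 / r) ^ m * r ^ e = ln (real n) ^ (m - e)"
      using ln e(2) by (simp add: r_def power_diff power_one_over)
    have nr: "real n powr r = exp 1" using ln elim by (simp add: r_def powr_def)
    have Beta: "Beta (a + 1 + real n) (b + d + 1 - r) \<le> B * (real n powr (- c) * exp 1)"
    proof -
      have "Beta (a + 1 + real n) (b + d + 1 - r) \<le> B * real n powr (- (b + d + 1 - r))"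
        using r elim by (intro B) (auto simp: c_def)
      also have "real n powr (- (b + d + 1 - r)) = real n powr (- c) * real n powr r"
        by (simp flip: powr_add add: c_def algebra_simps)
      finally show ?thesis unfolding nr .
    qed
    have "\<bar>integral {-1..1} (\<lambda>x. wjac a b n x * powr_ln d m 0 x)\<bar>
     \<le> real (Suc m) * 4 powr r * (1 / r) ^ m * Q * (2 powr (a + b + d - r + 1) * Beta (a + 1 + real n) (b + d + 1 - r))"
      unfolding Q_def using r c ab by (intro integral_powr_ln_bound) (auto simp: c_def)
    also have "\<dots> \<le> real (Suc m) * 4 powr 1 * (1 / r) ^ m * (A * real n powr (- d - 1) * r ^ e)
        * (2 powr (a + b + d + 1) * (B * (real n powr (- c) * exp 1)))"
    proof (intro mult_mono Q Beta powr_mono order_refl)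
      show "0 \<le> 2 powr (a + b + d - r + 1) * Beta (a + 1 + real n) (b + d + 1 - r)"
        using ab r c by (auto simp: Beta_def c_def intro!: mult_nonneg_nonneg divide_nonneg_pos Gamma_real_pos less_imp_le)
      show "0 \<le> Beta (a + 1 + real n) (b + d + 1 - r)"
        using ab r c by (auto simp: Beta_def c_def intro!: mult_nonneg_nonneg divide_nonneg_pos Gamma_real_pos less_imp_le)
    qed (use r A Q in auto)
    also have "\<dots> = M * ((real n powr (- d - 1) * real n powr (- c)) * ((1 / r) ^ m * r ^ e))"
      by (simp add: M_def del: of_nat_Suc)
    also have "real n powr (- d - 1) * real n powr (- c) = real n powr (- b - 2 * d - 2)"
      by (simp flip: powr_add add: c_def algebra_simps)
    finally show ?case unfolding lnm using ln by (simp add: abs_mult)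
  qed
qed

section \<open>Taylor remainders and the Jacobi coefficients\<close>

lemma fact_ge_power: "fact m * real m ^ k \<le> fact (m + k)"
proof (induction k)
  case (Suc k)
  have "real m * (fact m * real m ^ k) \<le> real (m + Suc k) * fact (m + k)"
    using Suc by (intro mult_mono) auto
  then show ?case by (simp add: mult_ac del: of_nat_add)
qed simp

text \<open>By |y| <= 1 + y^2 the integral is at most that of the weight plus the square norm, which
  stays bounded. The decay in n will come from integrations by parts alone.\<close>

lemma integral_wjac_bounded:
  assumes ab: "a > -1" "b > -1"
  obtains C where "C \<ge> 0" "\<And>n. n \<ge> 1 \<Longrightarrow> integral {-1..1} (\<lambda>x. \<bar>wjac a b n x\<bar>) \<le> C"
    "\<And>n. (\<lambda>x. \<bar>wjac a b n x\<bar>) integrable_on {-1..1}"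
proof -
  have "Bseq (\<lambda>n. real n * jacobi_sqnorm a b n)"
    using jacobi_sqnorm_limit[OF ab] by (intro convergent_imp_Bseq convergentI)
  then obtain M where M: "M > 0" "\<And>n. \<bar>real n * jacobi_sqnorm a b n\<bar> \<le> M"
    unfolding Bseq_def by auto
  define W where "W = integral {-1..1} (jacobi_weight a b)"
  have iw: "jacobi_weight a b integrable_on {-1..1}"
    using has_integral_jacobi_weight[OF ab] by blast
  have ip: "(\<lambda>x. wjac a b n x * poly p x) integrable_on {-1..1}" for n p
    using wjac_symbol_integrable[OF symbol_poly, of a b n p] ab by simp
  have i2: "(\<lambda>x. jacobi_weight a b x * (jacobi a b n x)\<^sup>2) integrable_on {-1..1}" for n
    using ip[of n "jacobi_poly a b n"] by (simp add: poly_jacobi_poly wjac_def power2_eq_square mult.assoc)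
  have bound: "\<bar>wjac a b n x\<bar> \<le> jacobi_weight a b x + jacobi_weight a b x * (jacobi a b n x)\<^sup>2" for n x
  proof -
    have "\<bar>y\<bar> \<le> 1 + y\<^sup>2" for y :: real
    proof -
      have "0 \<le> (\<bar>y\<bar> - 1)\<^sup>2" by simp
      then show ?thesis by (simp add: power2_diff)
    qed
    from mult_left_mono[OF this[of "jacobi a b n x"], of "jacobi_weight a b x"]
    show ?thesis by (simp add: wjac_def abs_mult jacobi_weight_def algebra_simps)
  qed
  have iabs: "(\<lambda>x. \<bar>wjac a b n x\<bar>) integrable_on {-1..1}" for n
  proof -
    have "(\<lambda>x. wjac a b n x) absolutely_integrable_on {-1..1}"
    proof (rule absolutely_integrable_integrable_bound)
      show "(\<lambda>x. wjac a b n x) integrable_on {-1..1}" using ip[of n 1] by simp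
      show "(\<lambda>x. jacobi_weight a b x + jacobi_weight a b x * (jacobi a b n x)\<^sup>2) integrable_on {-1..1}"
        by (intro integrable_add iw i2)
    qed (use bound in auto)
    then show ?thesis unfolding absolutely_integrable_on_def by simp
  qed
  show ?thesis
  proof (rule that)
    have "W \<ge> 0" unfolding W_def by (intro integral_nonneg iw) (auto simp: jacobi_weight_def)
    then show "W + M \<ge> 0" using M by simp
    fix n :: nat assume n: "n \<ge> 1"
    have "integral {-1..1} (\<lambda>x. \<bar>wjac a b n x\<bar>)
        \<le> integral {-1..1} (\<lambda>x. jacobi_weight a b x + jacobi_weight a b x * (jacobi a b n x)\<^sup>2)"
      by (intro integral_le iabs integrable_add iw i2 bound)
    also have "\<dots> = W + jacobi_sqnorm a b n"
      unfolding W_def jacobi_sqnorm_def by (intro integral_add iw i2)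
    also have "jacobi_sqnorm a b n \<le> M"
    proof -
      have "jacobi_sqnorm a b n \<ge> 0" unfolding jacobi_sqnorm_def
        by (intro integral_nonneg i2) (auto simp: jacobi_weight_def)
      then have "1 * jacobi_sqnorm a b n \<le> real n * jacobi_sqnorm a b n"
        using n by (intro mult_right_mono) auto
      then show ?thesis using M(2)[of n] by simp
    qed
    finally show "integral {-1..1} (\<lambda>x. \<bar>wjac a b n x\<bar>) \<le> W + M" by simp
  qed (rule iabs)
qed

text \<open>Each of the k integrations by parts gains a factor of order 1 / n. The k-th derivative
  is bounded because s >= k, and \<open>integral_wjac_bounded\<close> applies with the fixed
  exponents a + k and b + k.\<close>

lemma integral_symbol_bigo:
  assumes F: "symbol F s" and s: "s \<ge> real k" and ab: "a > -1" "b > -1"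
  shows "(\<lambda>n. integral {-1..1} (\<lambda>x. wjac a b n x * F 0 x)) \<in> O(\<lambda>n. real n powr (- real k))"
proof -
  have abk: "a + real k > -1" "b + real k > -1" using ab by auto
  obtain C where C: "C \<ge> 0" "\<And>n. n \<ge> 1 \<Longrightarrow> integral {-1..1} (\<lambda>x. \<bar>wjac (a + real k) (b + real k) n x\<bar>) \<le> C"
    "\<And>n. (\<lambda>x. \<bar>wjac (a + real k) (b + real k) n x\<bar>) integrable_on {-1..1}"
    using integral_wjac_bounded[OF abk] by blast
  obtain A where A: "A \<ge> 0" "\<And>x. x \<in> {-1<..<1} \<Longrightarrow> \<bar>F k x\<bar> \<le> A * (1 + x) powr (s - real k)"
    using symbolD(2)[OF F, of k] by auto
  define A' where "A' = A * 2 powr (s - real k)"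
  have A': "\<bar>F k x\<bar> \<le> A'" if "x \<in> {-1<..<1}" for x
    using A(2)[OF that] mult_left_mono[OF powr_mono2[of "s - real k" "1 + x" 2] A(1)] that s
    by (auto simp: A'_def)
  have "A' \<ge> 0" using A by (simp add: A'_def)
  have sk: "symbol (\<lambda>j. F (k + j)) (s - real k)"
  proof (induction k)
    case (Suc k)
    from symbol_shift[OF this] show ?case by (simp add: algebra_simps)
  qed (use F in simp)
  show ?thesis
  \<comment> \<open>n > 2 k gives n - k >= n / 2; the resulting loss of 2^k is offset by the 2^k in
    the denominator.\<close>
  proof (intro bigoI[of _ "A' * C"], use eventually_gt_at_top[of "2 * k"] in eventually_elim)
    case (elim n)
    let ?I = "integral {-1..1} (\<lambda>x. wjac (a + real k) (b + real k) (n - k) x * F k x)"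
    have e: "integral {-1..1} (\<lambda>x. wjac a b n x * F 0 x) = fact (n - k) / (2 ^ k * fact n) * ?I"
      by (rule integral_wjac_iterated_parts[OF F]) (use ab s elim in auto)
    \<comment> \<open>The bound on \<open>F k\<close> is known only inside the open
      interval.\<close>
    have "norm ?I = norm (integral {-1<..<1} (\<lambda>x. wjac (a + real k) (b + real k) (n - k) x * F k x))"
      by (simp add: integral_open_interval_real)
    also have "\<dots> \<le> integral {-1<..<1} (\<lambda>x. A' * \<bar>wjac (a + real k) (b + real k) (n - k) x\<bar>)"
    proof (rule integral_norm_bound_integral)
      have "(\<lambda>x. wjac (a + real k) (b + real k) (n - k) x * F k x) integrable_on {-1..1}"
        using wjac_symbol_integrable[OF sk, of "a + real k" "b + real k" "n - k"] ab s by simp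
      then show "(\<lambda>x. wjac (a + real k) (b + real k) (n - k) x * F k x) integrable_on {-1<..<1}"
        by (simp add: integrable_on_Icc_iff_Ioo)
      show "(\<lambda>x. A' * \<bar>wjac (a + real k) (b + real k) (n - k) x\<bar>) integrable_on {-1<..<1}"
        using C(3) by (simp add: integrable_on_Icc_iff_Ioo integrable_on_mult_right)
      fix x :: real assume "x \<in> {-1<..<1}"
      then show "norm (wjac (a + real k) (b + real k) (n - k) x * F k x) \<le> A' * \<bar>wjac (a + real k) (b + real k) (n - k) x\<bar>"
        using mult_right_mono[OF A', of x "\<bar>wjac (a + real k) (b + real k) (n - k) x\<bar>"]
        by (simp add: abs_mult mult.commute)
    qed
    also have "\<dots> = A' * integral {-1..1} (\<lambda>x. \<bar>wjac (a + real k) (b + real k) (n - k) x\<bar>)"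
      by (simp add: integral_open_interval_real)
    also have "\<dots> \<le> A' * C" using elim \<open>A' \<ge> 0\<close> by (intro mult_left_mono C) auto
    finally have I: "\<bar>?I\<bar> \<le> A' * C" by simp
    have f: "fact (n - k) / (2 ^ k * fact n) \<le> real n powr (- real k)"
    proof -
      have "(real n / 2) ^ k \<le> real (n - k) ^ k" using elim by (intro power_mono) auto
      then have "fact (n - k) * (real n / 2) ^ k \<le> fact (n - k) * real (n - k) ^ k"
        by (intro mult_left_mono) auto
      also have "\<dots> \<le> fact n" using fact_ge_power[of "n - k" k] elim by simp
      finally have "fact (n - k) * real n ^ k \<le> 2 ^ k * fact n" by (simp add: power_divide field_simps)
      then have "fact (n - k) / (2 ^ k * fact n) \<le> 1 / real n ^ k"
        using elim by (simp add: field_simps)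
      also have "1 / real n ^ k = real n powr (- real k)"
        using elim by (simp add: powr_minus powr_realpow divide_inverse)
      finally show ?thesis .
    qed
    have "fact (n - k) / (2 ^ k * fact n) * \<bar>?I\<bar> \<le> real n powr (- real k) * (A' * C)"
      using I f by (intro mult_mono) auto
    then show ?case unfolding e by (simp add: abs_mult mult_ac)
  qed
qed

section \<open>Taylor remainders at -1\<close>

text \<open>The i-th derivative of the remainder of the Taylor polynomial of degree below K at -1.\<close>
definition taylor_rem :: "(nat \<Rightarrow> real \<Rightarrow> real) \<Rightarrow> nat \<Rightarrow> nat \<Rightarrow> real \<Rightarrow> real" where
  "taylor_rem D K i x = D i x - (\<Sum>k<K - i. D (k + i) (-1) / fact k * (1 + x) ^ k)"

text \<open>For i >= K the truncated difference \<open>K - i\<close> is 0, the sum is empty and the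
  remainder is \<open>D i\<close> itself, so a single formula serves all i.\<close>

lemma taylor_rem_has_derivative:
  assumes D: "(D i has_real_derivative D (Suc i) x) (at x within S)"
  shows "(taylor_rem D K i has_real_derivative taylor_rem D K (Suc i) x) (at x within S)"
proof -
  have "((\<lambda>x. D i x - (\<Sum>k<K - i. D (k + i) (-1) / fact k * (1 + x) ^ k)) has_real_derivative
      D (Suc i) x - (\<Sum>k<K - i. D (k + i) (-1) / fact k * (real k * (1 + x) ^ (k - 1)))) (at x within S)"
    by (auto intro!: derivative_eq_intros D simp: mult_ac)
  also have "(\<Sum>k<K - i. D (k + i) (-1) / fact k * (real k * (1 + x) ^ (k - 1)))
      = (\<Sum>k<K - Suc i. D (k + Suc i) (-1) / fact k * (1 + x) ^ k)"
  proof (cases "K - i")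
    case (Suc l)
    then have l: "K - Suc i = l" by simp
    have "(\<Sum>k<Suc l. D (k + i) (-1) / fact k * (real k * (1 + x) ^ (k - 1)))
       = (\<Sum>k<l. D (Suc k + i) (-1) / fact (Suc k) * (real (Suc k) * (1 + x) ^ k))"
      by (subst sum.lessThan_Suc_shift) simp
    then show ?thesis unfolding Suc l by (simp add: fact_Suc del: of_nat_Suc)
  qed auto
  finally show ?thesis unfolding taylor_rem_def[abs_def] .
qed

text \<open>Downward induction from i = K, where the remainder is merely bounded: for i < K it
  vanishes at -1, so the mean value estimate gains one power of 1 + x over its derivative.\<close>

lemma symbol_taylor_rem:
  assumes D: "\<And>i x. x \<in> {-1..1} \<Longrightarrow> (D i has_real_derivative D (Suc i) x) (at x within {-1..1})"
  shows "symbol (taylor_rem D K) (real K)"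
proof -
  have d: "(taylor_rem D K i has_real_derivative taylor_rem D K (Suc i) x) (at x within {-1..1})"
    if "x \<in> {-1..1}" for i x
    using D[OF that] by (rule taylor_rem_has_derivative)
  have bdd: "\<exists>C\<ge>0. \<forall>x\<in>{-1..1}. \<bar>taylor_rem D K i x\<bar> \<le> C" for i
  proof -
    have "continuous_on {-1..1} (taylor_rem D K i)" using d by (rule DERIV_continuous_on)
    then have "bounded (taylor_rem D K i ` {-1..1})"
      by (intro compact_imp_bounded compact_continuous_image) auto
    then obtain C where "\<forall>x\<in>{-1..1}. \<bar>taylor_rem D K i x\<bar> \<le> C" unfolding bounded_iff by auto
    then show ?thesis by (intro exI[of _ "max 0 C"]) (auto simp: le_max_iff_disj)
  qed
  have pw: "\<exists>C\<ge>0. \<forall>x\<in>{-1..1}. \<bar>taylor_rem D K i x\<bar> \<le> C * (1 + x) ^ (K - i)" if "i \<le> K" for i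
    using that
  proof (induction rule: inc_induct)
    case base
    show ?case using bdd by simp
  next
    case (step i)
    then obtain C where C: "C \<ge> 0" "\<And>x. x \<in> {-1..1} \<Longrightarrow> \<bar>taylor_rem D K (Suc i) x\<bar> \<le> C * (1 + x) ^ (K - Suc i)"
      by auto
    have z: "taylor_rem D K i (-1) = 0"
    proof -
      obtain l where l: "K - i = Suc l" using step by (cases "K - i") auto
      show ?thesis unfolding taylor_rem_def l by (subst sum.lessThan_Suc_shift) simp
    qed
    show ?case
    proof (intro exI[of _ C] conjI ballI C(1))
      fix x :: real assume x: "x \<in> {-1..1}"
      \<comment> \<open>The bound on the derivative increases with t, so on [-1, x] its value at x
        serves.\<close>
      have "norm (taylor_rem D K i x - taylor_rem D K i (-1)) \<le> (C * (1 + x) ^ (K - Suc i)) * norm (x - (-1))"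
      proof (rule field_differentiable_bound)
        fix t assume t: "t \<in> {-1..x}"
        then have t': "t \<in> {-1..1}" using x by auto
        show "(taylor_rem D K i has_real_derivative taylor_rem D K (Suc i) t) (at t within {-1..x})"
          using d[OF t'] by (rule DERIV_subset) (use x in auto)
        have "C * (1 + t) ^ (K - Suc i) \<le> C * (1 + x) ^ (K - Suc i)"
          using t C by (intro mult_left_mono power_mono) auto
        then show "norm (taylor_rem D K (Suc i) t) \<le> C * (1 + x) ^ (K - Suc i)"
          using C(2)[OF t'] by simp
      qed (use x in auto)
      also have "\<dots> = C * ((1 + x) ^ (K - Suc i) * (1 + x))" using x by simp
      also have "(1 + x) ^ (K - Suc i) * (1 + x) = (1 + x) ^ (K - i)"
        using step by (simp flip: power_Suc2 add: Suc_diff_Suc)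
      finally show "\<bar>taylor_rem D K i x\<bar> \<le> C * (1 + x) ^ (K - i)" using z by simp
    qed
  qed
  show ?thesis
  proof (rule symbol_bounded)
    show "(taylor_rem D K j has_real_derivative taylor_rem D K (Suc j) x) (at x)" if "x \<in> {-1<..<1}" for j x
      using d[of x j] that by (auto simp: at_within_Icc_at)
    show "\<exists>C. \<forall>x\<in>{-1<..<1}. \<bar>taylor_rem D K j x\<bar> \<le> C * (1 + x) powr (real K - real j)" if j: "j < K" for j
    proof -
      have "(1 + x) powr (real K - real j) = (1 + x) ^ (K - j)" if "x \<in> {-1<..<1}" for x
        using that j by (simp add: powr_realpow flip: of_nat_diff)
      then show ?thesis using pw[of j] j by fastforce
    qed
    show "\<exists>C. \<forall>x\<in>{-1<..<1}. \<bar>taylor_rem D K j x\<bar> \<le> C" for j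
      using bdd[of j] by fastforce
  qed
qed

section \<open>Assembly of the singular terms and the remainder\<close>

text \<open>The parameter e counts the saved logarithms, so that both cases share one proof. The
  exponent rises by one from the integral to the coefficient because the inverse square norm is
  O(n).\<close>

lemma jacobi_coeff_bigo:
  fixes \<alpha> \<beta> \<delta> :: real and \<mu> e :: nat and f g :: "real \<Rightarrow> real"
  assumes ab: "\<alpha> > -1" "\<beta> > -1" and bd: "\<beta> + \<delta> > -1"
    and g: "smooth_on {-1..1} g"
    and f: "\<And>x. x \<in> {-1<..1} \<Longrightarrow> f x = (1 + x) powr \<delta> * ln (1 + x) ^ \<mu> * g x"
    and e: "e = 0 \<or> (e = 1 \<and> \<delta> \<in> \<nat>)" "e \<le> \<mu>"
  shows "(\<lambda>n. \<bar>jacobi_coeff f \<alpha> \<beta> n\<bar>)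
           \<in> O(\<lambda>n. real n powr (- \<beta> - 2 * \<delta> - 1) * ln (real n) ^ (\<mu> - e))"
proof -
  obtain D where D: "\<And>x. x \<in> {-1..1} \<Longrightarrow> D 0 x = g x"
    "\<And>i x. x \<in> {-1..1} \<Longrightarrow> (D i has_real_derivative D (Suc i) x) (at x within {-1..1})"
    using g unfolding smooth_on_def by blast
  let ?B = "\<lambda>n. real n powr (- \<beta> - 2 * \<delta> - 2) * ln (real n) ^ (\<mu> - e)"
  \<comment> \<open>Large enough that n^(-k) is below the power of n in \<open>?B\<close>.\<close>
  define k where "k = nat \<lceil>\<beta> + 2 * \<delta> + 2\<rceil>"
  \<comment> \<open>The power sacrificed to the logarithm; half of the available margin keeps
    \<beta> + \<delta> - \<epsilon> above -1.\<close>
  define \<epsilon> where "\<epsilon> = (\<beta> + \<delta> + 1) / 2"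
  have eps: "\<epsilon> > 0" using bd by (simp add: \<epsilon>_def)
  \<comment> \<open>Expanding g to this order gives the remainder term an order of at least
    k.\<close>
  define K where "K = nat \<lceil>real k - (\<delta> - \<epsilon>)\<rceil>"
  have k: "real k \<ge> \<beta> + 2 * \<delta> + 2" unfolding k_def by linarith
  have K: "\<delta> - \<epsilon> + real K \<ge> real k" unfolding K_def by linarith
  define F where "F = (\<lambda>j x. \<Sum>i\<le>j. real (j choose i) * (powr_ln \<delta> \<mu> i x * taylor_rem D K (j - i) x))"
  have F: "symbol F (\<delta> - \<epsilon> + real K)"
    unfolding F_def using D(2) by (intro symbol_mult symbol_powr_ln symbol_taylor_rem eps)
  define c where "c i = D i (-1) / fact i" for i
  have split: "jacobi_weight \<alpha> \<beta> x * f x * jacobi \<alpha> \<beta> n x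
      = fact \<mu> * ((\<Sum>i<K. c i * (wjac \<alpha> \<beta> n x * powr_ln (\<delta> + real i) \<mu> 0 x)) + wjac \<alpha> \<beta> n x * F 0 x)"
    if x: "x \<in> {-1..1}" for n x
  \<comment> \<open>f is arbitrary at -1, but both sides contain \<open>0 powr \<beta>\<close>,
    which is 0. Elsewhere \<open>fact \<mu>\<close> undoes the normalisation in
    \<open>powr_ln\<close>.\<close>
  proof (cases "x = -1")
    case False
    then have x': "x \<in> {-1<..1}" using x by auto
    have "g x = (\<Sum>i<K. c i * (1 + x) ^ i) + taylor_rem D K 0 x"
      using D(1)[OF x] by (simp add: taylor_rem_def c_def)
    moreover have "powr_ln (\<delta> + real i) \<mu> 0 x = powr_ln \<delta> \<mu> 0 x * (1 + x) ^ i" for i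
      using x' by (simp add: powr_ln_0 powr_add powr_realpow)
    moreover have "f x = fact \<mu> * powr_ln \<delta> \<mu> 0 x * g x"
      using f[OF x'] by (simp add: powr_ln_0)
    ultimately show ?thesis
      by (simp add: F_def wjac_def algebra_simps sum_distrib_left)
  qed (simp add: wjac_def jacobi_weight_def)
  let ?P = "\<lambda>i n. integral {-1..1} (\<lambda>x. wjac \<alpha> \<beta> n x * powr_ln (\<delta> + real i) \<mu> 0 x)"
  let ?R = "\<lambda>n. integral {-1..1} (\<lambda>x. wjac \<alpha> \<beta> n x * F 0 x)"
  have eq: "integral {-1..1} (\<lambda>x. jacobi_weight \<alpha> \<beta> x * f x * jacobi \<alpha> \<beta> n x)
      = fact \<mu> * ((\<Sum>i<K. c i * ?P i n) + ?R n)" for n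
  proof (rule integral_unique, rule has_integral_eq[OF split[symmetric]])
    have iP: "(\<lambda>x. wjac \<alpha> \<beta> n x * powr_ln (\<delta> + real i) \<mu> 0 x) integrable_on {-1..1}" for i
      by (rule wjac_symbol_integrable[OF symbol_powr_ln[OF eps]]) (use ab bd in \<open>auto simp: \<epsilon>_def field_simps\<close>)
    have iR: "(\<lambda>x. wjac \<alpha> \<beta> n x * F 0 x) integrable_on {-1..1}"
      by (rule wjac_symbol_integrable[OF F]) (use ab K in auto)
    show "((\<lambda>x. fact \<mu> * ((\<Sum>i<K. c i * (wjac \<alpha> \<beta> n x * powr_ln (\<delta> + real i) \<mu> 0 x)) + wjac \<alpha> \<beta> n x * F 0 x))
       has_integral fact \<mu> * ((\<Sum>i<K. c i * ?P i n) + ?R n)) {-1..1}"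
      by (intro has_integral_mult_right has_integral_add has_integral_sum integrable_integral iP iR) auto
  qed
  have P: "?P i \<in> O(?B)" for i
  proof -
    \<comment> \<open>\<delta> + i is natural whenever \<delta> is, so the saved logarithm persists
      in every Taylor term.\<close>
    have "?P i \<in> O(\<lambda>n. real n powr (- \<beta> - 2 * (\<delta> + real i) - 2) * ln (real n) ^ (\<mu> - e))"
      using ab bd e by (intro integral_powr_ln_bigo) auto
    also have "(\<lambda>n. real n powr (- \<beta> - 2 * (\<delta> + real i) - 2) * ln (real n) ^ (\<mu> - e)) \<in> O(?B)"
    proof (intro bigoI[of _ 1], use eventually_ge_at_top[of 1] in eventually_elim)
      case (elim n)
      then have "real n powr (- \<beta> - 2 * (\<delta> + real i) - 2) \<le> real n powr (- \<beta> - 2 * \<delta> - 2)"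
        by (intro powr_mono) auto
      then show ?case by (simp add: abs_mult mult_right_mono)
    qed
    finally show ?thesis .
  qed
  have R: "?R \<in> O(?B)"
  proof -
    have "?R \<in> O(\<lambda>n. real n powr (- real k))"
      using F K ab by (intro integral_symbol_bigo)
    also have "(\<lambda>n. real n powr (- real k)) \<in> O(?B)"
    proof (intro bigoI[of _ 1], use eventually_ge_at_top[of 3] in eventually_elim)
      case (elim n)
      \<comment> \<open>ln n >= 1 ensures that the logarithmic factor of \<open>?B\<close> is at
        least 1.\<close>
      have "exp 1 \<le> real n" using exp_le elim by simp
      then have "1 \<le> ln (real n)" using elim by (simp add: ln_ge_iff)
      then have "1 \<le> ln (real n) ^ (\<mu> - e)" by simp
      moreover have "real n powr (- real k) \<le> real n powr (- \<beta> - 2 * \<delta> - 2)"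
        using elim k by (intro powr_mono) auto
      ultimately have "real n powr (- real k) * 1 \<le> ?B n" by (intro mult_mono) auto
      then show ?case by simp
    qed
    finally show ?thesis .
  qed
  have cP: "(\<lambda>n. c i * ?P i n) \<in> O(?B)" for i
    using P[of i] by (cases "c i = 0") auto
  have "(\<lambda>n. fact \<mu> * ((\<Sum>i<K. c i * ?P i n) + ?R n)) \<in> O(?B)"
    using R by (intro landau_o.big.cmult_in_iff[THEN iffD2] sum_in_bigo big_sum_in_bigo cP) auto
  then have "(\<lambda>n. jacobi_coeff f \<alpha> \<beta> n) \<in> O(\<lambda>n. real n * ?B n)"
    unfolding jacobi_coeff_def eq by (rule landau_o.big.mult[OF inverse_jacobi_sqnorm_bigo[OF ab]])
  also have "(\<lambda>n. real n * ?B n) \<in> O(\<lambda>n. real n powr (- \<beta> - 2 * \<delta> - 1) * ln (real n) ^ (\<mu> - e))"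
  proof (intro bigoI[of _ 1], use eventually_gt_at_top[of 0] in eventually_elim)
    case (elim n)
    have "real n powr (- \<beta> - 2 * \<delta> - 1) = real n powr 1 * real n powr (- \<beta> - 2 * \<delta> - 2)"
      unfolding powr_add[symmetric] by simp
    then show ?case using elim by simp
  qed
  finally show ?thesis by simp
qed

text \<open>The saving comes from the factor of the product that vanishes at z = 0, and there is one
  only for \<delta> = 0, 1, 2, and so on. Negative integers are therefore a case of their own, in
  which the bound keeps the full power of the logarithm.\<close>

theorem theorem2:
  fixes \<alpha> \<beta> \<delta> :: real and \<mu> :: nat and f g :: "real \<Rightarrow> real"
  assumes "\<alpha> > -1" and "\<beta> > -1"
    and "\<mu> \<ge> 1"
    and "\<beta> + \<delta> > -1"
    and "smooth_on {-1..1} g"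
    and "\<And>x. x \<in> {-1<..1} \<Longrightarrow> f x = (1 + x) powr \<delta> * ln (1 + x) ^ \<mu> * g x"
  shows "(\<delta> \<notin> \<int> \<longrightarrow>
           (\<lambda>n. \<bar>jacobi_coeff f \<alpha> \<beta> n\<bar>)
             \<in> O(\<lambda>n. real n powr (- \<beta> - 2 * \<delta> - 1) * ln (real n) ^ \<mu>)) \<and>
         (\<delta> \<in> \<int> \<and> \<delta> \<ge> 0 \<longrightarrow>
           (\<lambda>n. \<bar>jacobi_coeff f \<alpha> \<beta> n\<bar>)
             \<in> O(\<lambda>n. real n powr (- \<beta> - 2 * \<delta> - 1) * ln (real n) ^ (\<mu> - 1))) \<and>
         (\<delta> \<in> \<int> \<and> \<delta> < 0 \<longrightarrow>
           (\<lambda>n. \<bar>jacobi_coeff f \<alpha> \<beta> n\<bar>)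
             \<in> O(\<lambda>n. real n powr (- \<beta> - 2 * \<delta> - 1) * ln (real n) ^ \<mu>))"
proof -
  note bound = jacobi_coeff_bigo[OF assms(1,2,4,5,6)]
  have "(\<lambda>n. \<bar>jacobi_coeff f \<alpha> \<beta> n\<bar>) \<in> O(\<lambda>n. real n powr (- \<beta> - 2 * \<delta> - 1) * ln (real n) ^ \<mu>)"
    using bound[of 0] by simp
  moreover have "(\<lambda>n. \<bar>jacobi_coeff f \<alpha> \<beta> n\<bar>)
      \<in> O(\<lambda>n. real n powr (- \<beta> - 2 * \<delta> - 1) * ln (real n) ^ (\<mu> - 1))" if "\<delta> \<in> \<int>" "\<delta> \<ge> 0"
  proof -
    have "\<delta> \<in> \<nat>" using that by (auto elim!: Ints_cases simp: Nats_altdef2)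
    then show ?thesis using bound[of 1] assms(3) by simp
  qed
  ultimately show ?thesis by blast
qed

end
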